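(* (Christoffel formula for the non-Abelian 2D Toda hierarchy.) Let $M=(m_{i,j})_{i,j\ge0}$, $m_{i,j}\in\mathbb{R}^{p\times p}$, be a semi-infinite block matrix (not necessarily block Hankel), let $W(x)\in\mathbb{R}^{p\times p}[x]$ be a monic matrix polynomial of degree $N\ge1$, and let $\hat M:=W(\Lambda)M$. Let $M(t)$ and $\hat M(t)=W(\Lambda)M(t)$ be the matrices evolved with the scalar non-Abelian Toda flows, and assume that both admit block Gauss factorizations at $t$, with associated polynomials $P^{[i]}_k(x)$, $\hat P^{[i]}_k(x)$ and block norms $H_k(t),\hat H_k(t)$ (all depending on $t$). Let $\pi_k,\Pi_{k,N},\gamma_k(x)$ be the ($t$-dependent) matrices defined in the context in terms of the adapted root polynomials of $W$. Then for every $k\in\{0,1,2,\dots\}$ with $\det\Pi_{k,N}\ne0$, $$\hat P_k^{[1]}(x)W(x)=\Theta_*\left[\begin{array}{c|c}\Pi_{k,N}&\begin{matrix}P^{[1]}_k(x)\\ \vdots\\ P^{[1]}_{k+N-1}(x)\end{matrix}\\ \hline \pi_{k+N}&P^{[1]}_{k+N}(x)\end{array}\right],\qquad \hat H_k=\Theta_*\left[\begin{array}{c|c}\Pi_{k,N}&\begin{matrix}H_k\\0\\ \vdots\\0\end{matrix}\\ \hline \pi_{k+N}&0\end{array}\right],$$ and for every $k\in\{0,1,2,\dots\}$ with $\det\Pi_{k+1,N}\ne0$, $$(\hat P_k^{[2]}(x))^\top(\hat H_k)^{-1}=\Theta_*\left[\begin{array}{c|c}\Pi_{k+1,N}&\begin{matrix}0\\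 \vdots\\0\\ I_p\end{matrix}\\ \hline \gamma_k(x)&0\end{array}\right].$$
   Context: **Last quasideterminant.** For a block matrix with $A$ square and nonsingular, $\Theta_*\begin{bmatrix}A&B\\C&D\end{bmatrix}:=D-CA^{-1}B$. **Flows.** $\Lambda$ is the semi-infinite block shift matrix (blocks $I_p$ on the first block superdiagonal, zero elsewhere); for $W(x)=\sum_jA_jx^j$, $W(\Lambda):=\sum_jA_j\Lambda^j$ with $A_j$ acting as $\mathrm{diag}(A_j,A_j,\dots)$. For scalar times $t=(t_1,t_2)$, $t_i=(t_{i,j})_{j\ge0}$, $t_{i,j}\in\mathbb{R}$, put $V^{(0)}_i(t_i):=\exp\left(\sum_{j\ge0}t_{i,j}\Lambda^j\right)$, $M(t):=V_1^{(0)}(t_1)M\left(V_2^{(0)}(t_2)\right)^{-\top}$ and $\hat M(t):=V_1^{(0)}(t_1)\hat M\left(V_2^{(0)}(t_2)\right)^{-\top}=W(\Lambda)M(t)$ (times are taken such that these products are well defined). **Factorizations and polynomials.** $M(t)=S_1(t)^{-1}H(t)S_2(t)^{-\top}$ and $\hat M(t)=\hat S_1(t)^{-1}\hat H(t)\hat S_2(t)^{-\top}$ with $S_i,\hat S_i$ lower unitriangular block matrices (blocks $p\times p$, diagonal blocks $I_p$) and $H=\mathrm{diag}(H_0,H_1,\dots)$, $\hat H=\mathrm{diag}(\hat H_0,\hat H_1,\dots)$ block diagonal with nonsingular $p\times p$ blocks. With $\chi(x)=[I_p,I_px,I_px^2,\dots]^\top$ (block column), $P^{[i]}(x)=[P^{[i]}_0,P^{[i]}_1,\dots]^\top:=S_i(t)\chi(x)$,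 $\hat P^{[i]}(x):=\hat S_i(t)\chi(x)$, $i=1,2$. The Christoffel--Darboux kernel is $K_n(x,y):=\sum_{k=0}^n (P^{[2]}_k(y))^\top H_k^{-1}P^{[1]}_k(x)$. **Adapted root polynomials.** Let $x_1,\dots,x_q\in\mathbb{C}$ be the distinct zeros of $\det W(x)$, with multiplicities $\alpha_i$, $\sum_i\alpha_i=Np$, and $s_i=\dim\operatorname{Ker}W(x_i)$. A root polynomial of $W$ at $x_i$ is $v\in\mathbb{C}^p[x]$ with $v(x_i)\ne0$ and $W(x_i)v(x_i)=0$; its order is the order of the zero of $W(x)v(x)$ at $x=x_i$. For each $i$ choose root polynomials successively for $j=1,\dots,s_i$ so that the $j$-th one has the largest order $\kappa^{(i)}_j$ among all root polynomials at $x_i$ whose value at $x_i$ is not in the span of the values at $x_i$ of the previous $j-1$ chosen ones; let $v^{(i)}_{j,r}$, $0\le r\le\kappa^{(i)}_j-1$, be its Taylor coefficients at $x_i$ (so $\sum_{j=1}^{s_i}\kappa_j^{(i)}=\alpha_i$). The adapted root polynomials are $v^{(i)}_j(x)=\sum_{r=0}^{\kappa_j^{(i)}-1}v^{(i)}_{j,r}(x-x_i)^r$. **The matrices $\pi_k,\Pi_{k,N},\gamma_n$.** Put $\pi^{(r),(i)}_{j,k}:=\frac{d^r(P^{[1]}_kv^{(i)}_j)}{dx^r}\big|_{x=x_i}\in\mathbb{C}^p$, $\pi_k^{(i)}:=[\pi^{(0),(i)}_{1,k},\dots,\pi^{(\kappa^{(i)}_1-1),(i)}_{1,k},\dots,\pi^{(0),(i)}_{s_i,k},\dots,\pi^{(\kappa^{(i)}_{s_i}-1),(i)}_{s_i,k}]\in\mathbb{C}^{p\times\alpha_i}$,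 $\pi_k:=[\pi_k^{(1)},\dots,\pi_k^{(q)}]\in\mathbb{C}^{p\times Np}$, and $\Pi_{k,N}:=\begin{bmatrix}\pi_k\\ \vdots\\ \pi_{k+N-1}\end{bmatrix}\in\mathbb{C}^{Np\times Np}$. Similarly, $\gamma^{(r),(i)}_{j,n}(y):=\frac{d^r(K_n(x,y)v^{(i)}_j(x))}{dx^r}\big|_{x=x_i}\in\mathbb{C}^p[y]$, and $\gamma_n(y)\in\mathbb{C}^{p\times Np}[y]$ is the row arrangement of these columns in the same order as in $\pi_k$. *)

theory Defs
  imports
    Complex_Main
    "Jordan_Normal_Form.Determinant"
    "Jordan_Normal_Form.Gauss_Jordan_Elimination"
    "Jordan_Normal_Form.Matrix_Kernel"
begin

section \<open>Inverses and the last quasideterminant\<close>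

text \<open>Only meaningful for invertible matrices.\<close>

definition minv :: "'a :: field mat \<Rightarrow> 'a mat" where
  "minv A = the (mat_inverse A)"

text \<open>\<open>last_quasidet A B C D\<close> is the last quasideterminant of the block matrix with
  rows \<open>[A B]\<close> and \<open>[C D]\<close>.\<close>

definition last_quasidet :: "'a :: field mat \<Rightarrow> 'a mat \<Rightarrow> 'a mat \<Rightarrow> 'a mat \<Rightarrow> 'a mat" where
  "last_quasidet A B C D = D - C * minv A * B"

section \<open>Semi-infinite block matrices\<close>

text \<open>A semi-infinite block matrix is the function that gives its \<open>(i, j)\<close> block; all blocks are
  \<open>p \<times> p\<close>.  Products and series are taken entrywise as (ordinary) sums of series, which is a finite
  sum whenever almost all terms vanish.  When infinitely many terms can occur, convergence has to be
  required separately, by \<open>bprod_defined\<close>.\<close>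

type_synonym bmat = "nat \<Rightarrow> nat \<Rightarrow> real mat"

definition is_bmat :: "nat \<Rightarrow> bmat \<Rightarrow> bool" where
  "is_bmat p A \<longleftrightarrow> (\<forall>i j. A i j \<in> carrier_mat p p)"

definition bprod_defined :: "nat \<Rightarrow> bmat \<Rightarrow> bmat \<Rightarrow> bool" where
  "bprod_defined p A B \<longleftrightarrow>
     (\<forall>i j. \<forall>a<p. \<forall>b<p. summable (\<lambda>k. (A i k * B k j) $$ (a, b)))"

definition bprod :: "nat \<Rightarrow> bmat \<Rightarrow> bmat \<Rightarrow> bmat" where
  "bprod p A B = (\<lambda>i j. mat p p (\<lambda>(a, b). \<Sum>k. (A i k * B k j) $$ (a, b)))"

definition bseries :: "nat \<Rightarrow> (nat \<Rightarrow> bmat) \<Rightarrow> bmat" where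
  "bseries p F = (\<lambda>i j. mat p p (\<lambda>(a, b). \<Sum>n. F n i j $$ (a, b)))"

definition bscale :: "real \<Rightarrow> bmat \<Rightarrow> bmat" where
  "bscale c A = (\<lambda>i j. c \<cdot>\<^sub>m A i j)"

definition btranspose :: "bmat \<Rightarrow> bmat" where
  "btranspose A = (\<lambda>i j. transpose_mat (A j i))"

definition bdiag :: "nat \<Rightarrow> (nat \<Rightarrow> real mat) \<Rightarrow> bmat" where
  "bdiag p D = (\<lambda>i j. if i = j then D i else 0\<^sub>m p p)"

definition bone :: "nat \<Rightarrow> bmat" where
  "bone p = bdiag p (\<lambda>_. 1\<^sub>m p)"

definition bshift :: "nat \<Rightarrow> bmat" where
  "bshift p = (\<lambda>i j. if j = Suc i then 1\<^sub>m p else 0\<^sub>m p p)"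

fun bpow :: "nat \<Rightarrow> bmat \<Rightarrow> nat \<Rightarrow> bmat" where
  "bpow p A 0 = bone p"
| "bpow p A (Suc n) = bprod p A (bpow p A n)"

definition bexp :: "nat \<Rightarrow> bmat \<Rightarrow> bmat" where
  "bexp p A = bseries p (\<lambda>n. bscale (1 / fact n) (bpow p A n))"

definition is_binverse :: "nat \<Rightarrow> bmat \<Rightarrow> bmat \<Rightarrow> bool" where
  "is_binverse p A B \<longleftrightarrow> is_bmat p B \<and>
     bprod_defined p A B \<and> bprod p A B = bone p \<and>
     bprod_defined p B A \<and> bprod p B A = bone p"

text \<open>Used only for block triangular matrices with nonsingular diagonal blocks.  Such a matrix has
  exactly one two-sided inverse: the products on one side are finite sums, and they determine the
  inverse recursively.\<close>

definition binv :: "nat \<Rightarrow> bmat \<Rightarrow> bmat" where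
  "binv p A = (THE B. is_binverse p A B)"

definition lower_unitriangular :: "nat \<Rightarrow> bmat \<Rightarrow> bool" where
  "lower_unitriangular p S \<longleftrightarrow> is_bmat p S \<and>
     (\<forall>i. S i i = 1\<^sub>m p) \<and> (\<forall>i j. i < j \<longrightarrow> S i j = 0\<^sub>m p p)"

text \<open>\<open>M = S1\<^sup>-\<^sup>1 H S2\<^sup>-\<^sup>T\<close>\<close>

definition block_gauss :: "nat \<Rightarrow> bmat \<Rightarrow> bmat \<Rightarrow> (nat \<Rightarrow> real mat) \<Rightarrow> bmat \<Rightarrow> bool" where
  "block_gauss p M S1 H S2 \<longleftrightarrow>
     lower_unitriangular p S1 \<and> lower_unitriangular p S2 \<and>
     (\<forall>k. H k \<in> carrier_mat p p \<and> invertible_mat (H k)) \<and>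
     M = bprod p (bprod p (binv p S1) (bdiag p H)) (btranspose (binv p S2))"

section \<open>Matrix polynomials\<close>

definition mpoly_coeff :: "real poly mat \<Rightarrow> nat \<Rightarrow> real mat" where
  "mpoly_coeff W j = map_mat (\<lambda>f. coeff f j) W"

definition monic_mpoly :: "nat \<Rightarrow> nat \<Rightarrow> real poly mat \<Rightarrow> bool" where
  "monic_mpoly p N W \<longleftrightarrow> W \<in> carrier_mat p p \<and>
     mpoly_coeff W N = 1\<^sub>m p \<and> (\<forall>j>N. mpoly_coeff W j = 0\<^sub>m p p)"

definition cmat :: "real mat \<Rightarrow> complex mat" where
  "cmat A = map_mat complex_of_real A"

definition cpoly_mat :: "real poly mat \<Rightarrow> complex poly mat" where
  "cpoly_mat P = map_mat (map_poly complex_of_real) P"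

definition mat_at :: "complex poly mat \<Rightarrow> complex \<Rightarrow> complex mat" where
  "mat_at P x = map_mat (\<lambda>f. poly f x) P"

definition vec_at :: "complex poly vec \<Rightarrow> complex \<Rightarrow> complex vec" where
  "vec_at v x = map_vec (\<lambda>f. poly f x) v"

text \<open>\<open>W(\<Lambda>)\<close>; the coefficients \<open>A\<^sub>j\<close> act as \<open>diag(A\<^sub>j, A\<^sub>j, \<dots>)\<close>.\<close>

definition mpoly_at_shift :: "nat \<Rightarrow> real poly mat \<Rightarrow> bmat" where
  "mpoly_at_shift p W =
     bseries p (\<lambda>j. bprod p (bdiag p (\<lambda>_. mpoly_coeff W j)) (bpow p (bshift p) j))"

text \<open>The \<open>k\<close>-th block of \<open>S \<chi>(x)\<close>, for \<open>S\<close> block lower triangular.\<close>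

definition gauss_poly :: "nat \<Rightarrow> bmat \<Rightarrow> nat \<Rightarrow> real poly mat" where
  "gauss_poly p S k = mat p p (\<lambda>(a, b). \<Sum>j\<le>k. monom (S k j $$ (a, b)) j)"

section \<open>Toda flows\<close>

definition toda_wave :: "nat \<Rightarrow> (nat \<Rightarrow> real) \<Rightarrow> bmat" where
  "toda_wave p t = bexp p (bseries p (\<lambda>j. bscale (t j) (bpow p (bshift p) j)))"

definition toda_defined :: "nat \<Rightarrow> (nat \<Rightarrow> real) \<Rightarrow> (nat \<Rightarrow> real) \<Rightarrow> bmat \<Rightarrow> bool" where
  "toda_defined p t1 t2 M \<longleftrightarrow>
     bprod_defined p (toda_wave p t1) M \<and>
     bprod_defined p (bprod p (toda_wave p t1) M) (btranspose (binv p (toda_wave p t2)))"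

definition toda_evolve :: "nat \<Rightarrow> (nat \<Rightarrow> real) \<Rightarrow> (nat \<Rightarrow> real) \<Rightarrow> bmat \<Rightarrow> bmat" where
  "toda_evolve p t1 t2 M =
     bprod p (bprod p (toda_wave p t1) M) (btranspose (binv p (toda_wave p t2)))"

section \<open>Adapted root polynomials\<close>

text \<open>Order of the zero of a nonzero vector of polynomials at \<open>x0\<close>.\<close>

definition zero_order :: "complex \<Rightarrow> complex poly vec \<Rightarrow> nat" where
  "zero_order x0 u = Max {m. \<forall>a<dim_vec u. [:- x0, 1:] ^ m dvd u $ a}"

definition root_poly :: "nat \<Rightarrow> complex poly mat \<Rightarrow> complex \<Rightarrow> complex poly vec \<Rightarrow> bool" where
  "root_poly p W x0 v \<longleftrightarrow> v \<in> carrier_vec p \<and>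
     vec_at v x0 \<noteq> 0\<^sub>v p \<and> mat_at W x0 *\<^sub>v vec_at v x0 = 0\<^sub>v p"

definition root_order :: "complex poly mat \<Rightarrow> complex \<Rightarrow> complex poly vec \<Rightarrow> nat" where
  "root_order W x0 v = zero_order x0 (W *\<^sub>v v)"

abbreviation vspan :: "nat \<Rightarrow> complex vec set \<Rightarrow> complex vec set" where
  "vspan p \<equiv> LinearCombinations.module.span class_ring (module_vec TYPE(complex) p)"

definition maximal_root_polys ::
  "nat \<Rightarrow> complex poly mat \<Rightarrow> complex \<Rightarrow> nat \<Rightarrow> (nat \<Rightarrow> complex poly vec) \<Rightarrow> bool" where
  "maximal_root_polys p W x0 s u \<longleftrightarrow>
     (\<forall>j<s. root_poly p W x0 (u j) \<and>
            vec_at (u j) x0 \<notin> vspan p ((\<lambda>l. vec_at (u l) x0) ` {..<j}) \<and>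
            (\<forall>w. root_poly p W x0 w \<longrightarrow>
                 vec_at w x0 \<notin> vspan p ((\<lambda>l. vec_at (u l) x0) ` {..<j}) \<longrightarrow>
                 root_order W x0 w \<le> root_order W x0 (u j)))"

definition taylor_truncate :: "complex \<Rightarrow> nat \<Rightarrow> complex poly vec \<Rightarrow> complex poly vec" where
  "taylor_truncate x0 m u =
     map_vec (\<lambda>f. \<Sum>r<m. Polynomial.smult (poly ((pderiv ^^ r) f) x0 / fact r) ([:- x0, 1:] ^ r)) u"

section \<open>The matrices built from the root polynomials\<close>

text \<open>\<open>N\<close> block rows \<open>B 0, \<dots>, B (N - 1)\<close> with \<open>p\<close> rows each.  When the blocks are the jets below, the
  column count is \<open>\<Sum>\<^sub>i \<Sum>\<^sub>j \<kappa>\<^sub>j\<^sup>(\<^sup>i\<^sup>)\<close>, which is \<open>N p\<close> for a maximal choice of root polynomials of a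
  monic \<open>W\<close> of degree \<open>N\<close>; that equality is not built into the definition.  Note that \<open>det\<close> is \<open>0\<close>
  on non-square matrices.\<close>

definition block_column :: "nat \<Rightarrow> nat \<Rightarrow> (nat \<Rightarrow> complex mat) \<Rightarrow> complex mat" where
  "block_column p N B = mat (N * p) (dim_col (B 0)) (\<lambda>(r, b). B (r div p) $$ (r mod p, b))"

text \<open>Row arrangement of the columns \<open>d\<^sup>r(F v\<^sup>(\<^sup>i\<^sup>)\<^sub>j)/dx\<^sup>r\<close> at \<open>x\<^sub>i\<close>, for \<open>i < q\<close>, \<open>j < s i\<close>,
  \<open>r < \<kappa> i j\<close>, ordered lexicographically in \<open>(i, j, r)\<close>.\<close>

definition root_jets ::
  "nat \<Rightarrow> nat \<Rightarrow> (nat \<Rightarrow> complex) \<Rightarrow> (nat \<Rightarrow> nat) \<Rightarrow> (nat \<Rightarrow> nat \<Rightarrow> nat) \<Rightarrow>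
   (nat \<Rightarrow> nat \<Rightarrow> complex poly vec) \<Rightarrow> complex poly mat \<Rightarrow> complex mat" where
  "root_jets p q x s \<kappa> v F =
     mat_of_cols p [map_vec (\<lambda>f. poly ((pderiv ^^ r) f) (x i)) (F *\<^sub>v v i j).
                    i \<leftarrow> [0..<q], j \<leftarrow> [0..<s i], r \<leftarrow> [0..<\<kappa> i j]]"

text \<open>\<open>K\<^sub>n(x, y)\<close> for a fixed complex number \<open>y\<close>, as a matrix polynomial in \<open>x\<close>.\<close>

definition CD_kernel ::
  "nat \<Rightarrow> (nat \<Rightarrow> real poly mat) \<Rightarrow> (nat \<Rightarrow> real poly mat) \<Rightarrow> (nat \<Rightarrow> real mat) \<Rightarrow>
   nat \<Rightarrow> complex \<Rightarrow> complex poly mat" where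
  "CD_kernel p P1 P2 H n y =
     mat p p (\<lambda>(a, b). \<Sum>k\<le>n.
       (map_mat (\<lambda>c. [:c:]) (transpose_mat (mat_at (cpoly_mat (P2 k)) y) * cmat (minv (H k)))
          * cpoly_mat (P1 k)) $$ (a, b))"

end

theory Submission
  imports Defs "HOL-Computational_Algebra.Formal_Power_Series"
begin

text \<open>
  The Toda flows commute with left multiplication by \<open>W(\<Lambda>)\<close>, so \<open>t\<close> only enters through the matrices
  that are factorised.  Let \<open>T\<^sub>i\<close> and \<open>K\<close> be the hatted factors.  Equating the two factorisations of
  \<open>W(\<Lambda>) M(t)\<close> shows that the resolvent \<open>\<omega> = T\<^sub>1 W(\<Lambda>) S\<^sub>1\<^sup>-\<^sup>1 = K T\<^sub>2\<^sup>-\<^sup>T S\<^sub>2\<^sup>T H\<^sup>-\<^sup>1\<close> is block upper triangular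
  with \<open>N\<close> superdiagonals, its diagonal blocks being \<open>K\<^sub>k H\<^sub>k\<^sup>-\<^sup>1\<close> and its last superdiagonal \<open>I\<^sub>p\<close>.  Hence the
  \<open>k\<close>-th new polynomial times \<open>W\<close> is a combination of \<open>P\<^sub>k, \<dots>, P\<^sub>k\<^sub>+\<^sub>N\<close> with coefficients from the \<open>k\<close>-th row of
  \<open>\<omega>\<close>.  The jets along the root polynomials annihilate all multiples of \<open>W\<close>, which gives a linear
  system for the coefficients; solving it yields the quasideterminants.  For the second family the same
  jets are applied to the difference of the new Christoffel--Darboux kernel, times \<open>W\<close>, and the old one.
\<close>

section \<open>Semi-infinite block matrices\<close>

declare index_mult_mat(1) [simp del]

lemma index_mult_square:
  assumes "A \<in> carrier_mat p p" "B \<in> carrier_mat p p" "a < p" "b < p"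
  shows "(A * B) $$ (a, b) = (\<Sum>c<p. A $$ (a, c) * B $$ (c, b))"
  using assms by (simp add: index_mult_mat(1) scalar_prod_def atLeast0LessThan)

lemma is_bmatD [simp]:
  assumes "is_bmat p A"
  shows "A i j \<in> carrier_mat p p" "dim_row (A i j) = p" "dim_col (A i j) = p"
  using assms unfolding is_bmat_def by (meson carrier_matD)+

lemma bmat_eqI:
  assumes "is_bmat p A" "is_bmat p B"
    and "\<And>i j a b. a < p \<Longrightarrow> b < p \<Longrightarrow> A i j $$ (a, b) = B i j $$ (a, b)"
  shows "A = B"
proof (intro ext)
  fix i j
  show "A i j = B i j" using assms by (intro eq_matI) simp_all
qed

lemma is_bmat_bprod [simp]: "is_bmat p (bprod p A B)"
  by (simp add: is_bmat_def bprod_def)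

lemma is_bmat_btranspose [simp]: "is_bmat p A \<Longrightarrow> is_bmat p (btranspose A)"
  by (simp add: is_bmat_def btranspose_def)

lemma is_bmat_bdiag [simp]: "(\<And>k. D k \<in> carrier_mat p p) \<Longrightarrow> is_bmat p (bdiag p D)"
  by (simp add: is_bmat_def bdiag_def)

lemma is_bmat_bone [simp]: "is_bmat p (bone p)"
  by (simp add: bone_def)

lemma is_bmat_lower [simp]: "lower_unitriangular p S \<Longrightarrow> is_bmat p S"
  by (simp add: lower_unitriangular_def)

lemma lower_unitriangularD [simp]:
  assumes "lower_unitriangular p S"
  shows "S i i = 1\<^sub>m p" "i < j \<Longrightarrow> S i j = 0\<^sub>m p p"
  using assms unfolding lower_unitriangular_def by blast+

lemma btranspose_btranspose [simp]: "btranspose (btranspose A) = A"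
  by (simp add: btranspose_def)

text \<open>With such a left factor each entry of a product is a finite sum, whatever the right
  factor; this is what makes rearranging infinite block products legitimate.\<close>

definition row_finite :: "nat \<Rightarrow> bmat \<Rightarrow> bool" where
  "row_finite p A \<longleftrightarrow> is_bmat p A \<and> (\<forall>i. \<exists>r. \<forall>k\<ge>r. A i k = 0\<^sub>m p p)"

lemma row_finite_is_bmat [simp]: "row_finite p A \<Longrightarrow> is_bmat p A"
  by (simp add: row_finite_def)

text \<open>The cut-off \<open>r\<close> may depend on the row and the column, and each late term
  may be killed by either factor, so that row finite left factors, column finite right factors and
  triangular matrices are all covered.\<close>

lemma bprod_finite:
  assumes "is_bmat p A" "is_bmat p B" "a < p" "b < p"
    and "\<And>k. k \<ge> r \<Longrightarrow> A i k = 0\<^sub>m p p \<or> B k j = 0\<^sub>m p p"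
  shows "summable (\<lambda>k. (A i k * B k j) $$ (a, b))"
    and "bprod p A B i j $$ (a, b) = (\<Sum>k<r. \<Sum>c<p. A i k $$ (a, c) * B k j $$ (c, b))"
proof -
  have z: "(A i k * B k j) $$ (a, b) = 0" if "k \<notin> {..<r}" for k
    using assms(5)[of k] that assms(1-4) 
      left_mult_zero_mat[of "B k j" p p p] right_mult_zero_mat[of "A i k" p p p] by auto
  show "summable (\<lambda>k. (A i k * B k j) $$ (a, b))"
    using z by (intro summable_finite[of "{..<r}"]) auto
  have "bprod p A B i j $$ (a, b) = (\<Sum>k. (A i k * B k j) $$ (a, b))"
    using assms(3,4) by (simp add: bprod_def)
  also have "\<dots> = (\<Sum>k<r. (A i k * B k j) $$ (a, b))"
    using z by (intro suminf_finite) auto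
  also have "\<dots> = (\<Sum>k<r. \<Sum>c<p. A i k $$ (a, c) * B k j $$ (c, b))"
    using assms(1-4) by (intro sum.cong refl index_mult_square) simp_all
  finally show "bprod p A B i j $$ (a, b) = (\<Sum>k<r. \<Sum>c<p. A i k $$ (a, c) * B k j $$ (c, b))" .
qed

lemma bprod_defined_row_finite:
  assumes "row_finite p A" "is_bmat p B"
  shows "bprod_defined p A B"
  unfolding bprod_defined_def
proof (intro allI impI)
  fix i j a b assume "a < p" "b < p"
  moreover obtain r where "\<forall>k\<ge>r. A i k = 0\<^sub>m p p" 
    using assms(1) unfolding row_finite_def by blast
  ultimately show "summable (\<lambda>k. (A i k * B k j) $$ (a, b))"
    using assms by (intro bprod_finite(1)[where r=r]) auto
qed

lemma row_finite_bprod: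
  assumes "row_finite p A" "row_finite p B"
  shows "row_finite p (bprod p A B)"
  unfolding row_finite_def
proof (intro conjI allI)
  fix i
  obtain r where r: "\<forall>k\<ge>r. A i k = 0\<^sub>m p p" using assms(1) unfolding row_finite_def by blast
  obtain f where f: "\<And>k l. l \<ge> f k \<Longrightarrow> B k l = 0\<^sub>m p p"
    using assms(2) unfolding row_finite_def by metis
  \<comment> \<open>Row \<open>i\<close> of \<open>A\<close> meets only the rows
    \<open>k < r\<close> of \<open>B\<close>; the sum of their cut-offs \<open>f k\<close> bounds
    each of them.\<close>
  have "bprod p A B i l = 0\<^sub>m p p" if l: "l \<ge> (\<Sum>k<r. f k)" for l
  proof (rule eq_matI)
    fix a b assume ab: "a < dim_row (0\<^sub>m p p :: real mat)" "b < dim_col (0\<^sub>m p p :: real mat)"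
    have "B k l = 0\<^sub>m p p" if "k < r" for k
      using member_le_sum[of k "{..<r}" f] that l by (intro f) auto
    then have "bprod p A B i l $$ (a, b) = (\<Sum>k<0. \<Sum>c<p. A i k $$ (a, c) * B k l $$ (c, b))"
      using ab assms r by (intro bprod_finite) (simp_all, metis not_le)
    then show "bprod p A B i l $$ (a, b) = 0\<^sub>m p p $$ (a, b)" using ab by simp
  qed (simp_all add: bprod_def)
  then show "\<exists>r. \<forall>k\<ge>r. bprod p A B i k = 0\<^sub>m p p" by blast
qed simp

text \<open>Associativity can fail for infinite matrices. Here row finiteness of \<open>A\<close>
  makes the outer sum finite, so it may be exchanged with the inner series, whose convergence is
  \<open>bprod_defined p B C\<close>.\<close>

lemma bprod_assoc:
  assumes A: "row_finite p A" and B: "is_bmat p B" and C: "is_bmat p C"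
    and BC: "bprod_defined p B C"
  shows "bprod p A (bprod p B C) = bprod p (bprod p A B) C"
proof (rule bmat_eqI)
  fix i j a b assume ab: "a < p" "b < p"
  obtain r where r: "\<forall>k\<ge>r. A i k = 0\<^sub>m p p" using A by (auto simp: row_finite_def)
  note A' = row_finite_is_bmat[OF A]
  have s: "summable (\<lambda>l. A i k $$ (a, c) * (B k l * C l j) $$ (c, b))" if "c < p" for k c
    using BC that ab by (intro summable_mult) (simp add: bprod_defined_def)
  have "bprod p A (bprod p B C) i j $$ (a, b)
      = (\<Sum>k<r. \<Sum>c<p. A i k $$ (a, c) * bprod p B C k j $$ (c, b))"
    using A' ab r by (intro bprod_finite) auto
  also have "\<dots> = (\<Sum>k<r. \<Sum>c<p. \<Sum>l. A i k $$ (a, c) * (B k l * C l j) $$ (c, b))"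
    using BC ab by (intro sum.cong refl) (simp add: bprod_def suminf_mult bprod_defined_def)
  also have "\<dots> = (\<Sum>k<r. \<Sum>l. \<Sum>c<p. A i k $$ (a, c) * (B k l * C l j) $$ (c, b))"
    using s by (intro sum.cong refl suminf_sum[symmetric]) auto
  also have "\<dots> = (\<Sum>l. \<Sum>k<r. \<Sum>c<p. A i k $$ (a, c) * (B k l * C l j) $$ (c, b))"
    using s by (intro suminf_sum[symmetric] summable_sum) auto
  also have "\<dots> = (\<Sum>l. (bprod p A B i l * C l j) $$ (a, b))"
  proof (rule suminf_cong)
    fix l
    have "bprod p A B i l $$ (a, d) = (\<Sum>k<r. \<Sum>c<p. A i k $$ (a, c) * B k l $$ (c, d))" 
      if "d < p" for d
      using A' B ab r that by (intro bprod_finite(2)) blast+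
    then have "(bprod p A B i l * C l j) $$ (a, b)
        = (\<Sum>d<p. (\<Sum>k<r. \<Sum>c<p. A i k $$ (a, c) * B k l $$ (c, d)) * C l j $$ (d, b))"
      using C ab by (subst index_mult_square[where p=p]) simp_all
    also have "\<dots> = (\<Sum>d<p. \<Sum>k<r. \<Sum>c<p. A i k $$ (a, c) * (B k l $$ (c, d) * C l j $$ (d, b)))"
      by (simp only: sum_distrib_right mult.assoc)
    also have "\<dots> = (\<Sum>k<r. \<Sum>d<p. \<Sum>c<p. A i k $$ (a, c) * (B k l $$ (c, d) * C l j $$ (d, b)))"
      by (rule sum.swap)
    also have "\<dots> = (\<Sum>k<r. \<Sum>c<p. \<Sum>d<p. A i k $$ (a, c) * (B k l $$ (c, d) * C l j $$ (d, b)))"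
      by (intro sum.cong refl sum.swap)
    also have "\<dots> = (\<Sum>k<r. \<Sum>c<p. A i k $$ (a, c) * (B k l * C l j) $$ (c, b))"
      using B C ab by (intro sum.cong refl, subst index_mult_square[where p=p]) 
        (simp_all add: sum_distrib_left)
    finally show "(\<Sum>k<r. \<Sum>c<p. A i k $$ (a, c) * (B k l * C l j) $$ (c, b))
      = (bprod p A B i l * C l j) $$ (a, b)" by simp
  qed
  also have "\<dots> = bprod p (bprod p A B) C i j $$ (a, b)"
    using ab by (simp add: bprod_def[of p "bprod p A B"])
  finally show "bprod p A (bprod p B C) i j $$ (a, b) = bprod p (bprod p A B) C i j $$ (a, b)" .
qed simp_all

lemma row_finite_bdiag [simp]: 
  assumes "\<And>k. D k \<in> carrier_mat p p"
  shows "row_finite p (bdiag p D)"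
proof -
  have "\<exists>r. \<forall>k\<ge>r. bdiag p D i k = 0\<^sub>m p p" for i
    by (rule exI[of _ "Suc i"]) (auto simp: bdiag_def)
  with assms show ?thesis by (simp add: row_finite_def)
qed

lemma row_finite_lower_unitriangular [simp]: "lower_unitriangular p S \<Longrightarrow> row_finite p S"
  unfolding row_finite_def lower_unitriangular_def by (meson Suc_le_eq)

lemma bprod_bdiag_left:
  assumes "is_bmat p B" "\<And>k. D k \<in> carrier_mat p p"
  shows "bprod p (bdiag p D) B = (\<lambda>i j. D i * B i j)"
proof (rule bmat_eqI)
  show "is_bmat p (\<lambda>i j. D i * B i j)" using assms
    unfolding is_bmat_def by (intro allI mult_carrier_mat) auto
  fix i j a b assume ab: "a < p" "b < p"
  have "bprod p (bdiag p D) B i j $$ (a, b) = (\<Sum>k<Suc i. \<Sum>c<p. bdiag p D i k $$ (a, c) * B k j $$ (c, b))"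
    using assms ab by (intro bprod_finite is_bmat_bdiag) (auto simp: bdiag_def)
  also have "\<dots> = (\<Sum>k\<in>{i}. \<Sum>c<p. bdiag p D i k $$ (a, c) * B k j $$ (c, b))"
    using ab by (intro sum.mono_neutral_right) (auto simp: bdiag_def)
  also have "\<dots> = (D i * B i j) $$ (a, b)"
    using assms ab by (subst index_mult_square[where p=p]) (auto simp: bdiag_def)
  finally show "bprod p (bdiag p D) B i j $$ (a, b) = (D i * B i j) $$ (a, b)" .
qed simp

lemma btranspose_bprod:
  assumes "is_bmat p A" "is_bmat p B"
  shows "btranspose (bprod p A B) = bprod p (btranspose B) (btranspose A)"
proof (rule bmat_eqI)
  fix i j a b assume ab: "a < p" "b < p"
  have "(A j k * B k i) $$ (b, a) = (transpose_mat (B k i) * transpose_mat (A j k)) $$ (a, b)" for k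
    using assms ab by (subst transpose_mult[symmetric]) auto
  then show "btranspose (bprod p A B) i j $$ (a, b) = bprod p (btranspose B) (btranspose A) i j $$ (a, b)"
    using ab by (simp add: btranspose_def bprod_def)
qed (use assms in simp_all)

lemma btranspose_bdiag: "btranspose (bdiag p D) = bdiag p (\<lambda>k. transpose_mat (D k))"
  by (intro ext) (auto simp: btranspose_def bdiag_def)

lemma btranspose_bone [simp]: "btranspose (bone p) = bone p"
  by (simp add: bone_def btranspose_bdiag)

lemma bone_left [simp]: "is_bmat p A \<Longrightarrow> bprod p (bone p) A = A"
  unfolding bone_def by (subst bprod_bdiag_left) (auto intro!: ext)

lemma bprod_bdiag_right:
  assumes "is_bmat p B" "\<And>k. D k \<in> carrier_mat p p"
  shows "bprod p B (bdiag p D) = (\<lambda>i j. B i j * D j)"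
proof -
  have "btranspose (bprod p B (bdiag p D)) = (\<lambda>i j. transpose_mat (D i) * transpose_mat (B j i))"
    using assms by (simp add: btranspose_bprod btranspose_bdiag bprod_bdiag_left) (simp add: btranspose_def)
  also have "\<dots> = btranspose (\<lambda>i j. B i j * D j)"
    using assms by (auto intro!: ext transpose_mult[symmetric] simp: btranspose_def)
  finally show ?thesis by (metis btranspose_btranspose)
qed

lemma bone_right [simp]: "is_bmat p A \<Longrightarrow> bprod p A (bone p) = A"
  unfolding bone_def by (subst bprod_bdiag_right) (auto intro!: ext)

text \<open>A common frame for lower unitriangular matrices (\<open>n = 0\<close>), the matrix
  \<open>W(\<Lambda>)\<close> of a monic \<open>W\<close> of degree \<open>n\<close>, and the
  resolvent. Blocks below the last superdiagonal are arbitrary.\<close>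

definition unit_band :: "nat \<Rightarrow> nat \<Rightarrow> bmat \<Rightarrow> bool" where
  "unit_band p n A \<longleftrightarrow> is_bmat p A \<and>
     (\<forall>i. A i (i + n) = 1\<^sub>m p) \<and> (\<forall>i j. i + n < j \<longrightarrow> A i j = 0\<^sub>m p p)"

lemma lower_unitriangular_iff_unit_band: "lower_unitriangular p A \<longleftrightarrow> unit_band p 0 A"
  unfolding lower_unitriangular_def unit_band_def by simp

lemma unit_bandD:
  assumes "unit_band p n A"
  shows "is_bmat p A" "A i (i + n) = 1\<^sub>m p" "i + n < j \<Longrightarrow> A i j = 0\<^sub>m p p"
  using assms unfolding unit_band_def by blast+

lemma unit_band_row_finite: "unit_band p n A \<Longrightarrow> row_finite p A"
  unfolding row_finite_def unit_band_def by (meson Suc_le_eq)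

text \<open>For \<open>j \<ge> i + (m + n)\<close> a summand with \<open>k < i + m\<close> vanishes
  through \<open>B\<close> and one with \<open>k > i + m\<close> through \<open>A\<close>. Only
  \<open>k = i + m\<close> survives, where the block of \<open>A\<close> is the identity.\<close>

lemma unit_band_bprod:
  assumes A: "unit_band p m A" and B: "unit_band p n B"
  shows "unit_band p (m + n) (bprod p A B)"
proof -
  note [simp] = unit_bandD[OF A] unit_bandD[OF B]
  have 1: "bprod p A B i j $$ (a, b) = (if j = i + (m + n) then 1\<^sub>m p else 0\<^sub>m p p) $$ (a, b)" 
    if "a < p" "b < p" "i + (m + n) \<le> j" for i j a b
  proof -
    have "bprod p A B i j $$ (a, b) = (\<Sum>k<Suc (i + m). \<Sum>c<p. A i k $$ (a, c) * B k j $$ (c, b))"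
      using that by (intro bprod_finite) (simp_all add: Suc_le_eq)
    also have "\<dots> = (\<Sum>k\<in>{i + m}. \<Sum>c<p. A i k $$ (a, c) * B k j $$ (c, b))"
      using that by (intro sum.mono_neutral_right) simp_all
    also have "\<dots> = (1\<^sub>m p * B (i + m) j) $$ (a, b)" 
      using that by (subst index_mult_square[where p=p]) simp_all
    also have "1\<^sub>m p * B (i + m) j = B (i + m) j" by (intro left_mult_one_mat[of _ p p]) simp
    also have "\<dots> = (if j = i + (m + n) then 1\<^sub>m p else 0\<^sub>m p p)"
      using that unit_bandD(2)[OF B, of "i + m"] by (auto simp: add.assoc)
    finally show ?thesis .
  qed
  show ?thesis unfolding unit_band_def
  proof (intro conjI allI impI)
    show "bprod p A B i (i + (m + n)) = 1\<^sub>m p" for i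
      using 1[of _ _ i "i + (m + n)"] by (intro eq_matI) auto
    show "bprod p A B i j = 0\<^sub>m p p" if "i + (m + n) < j" for i j
      using 1[of _ _ i j] that by (intro eq_matI) auto
  qed simp
qed

lemma lower_unitriangular_bprod:
  "lower_unitriangular p A \<Longrightarrow> lower_unitriangular p B \<Longrightarrow> lower_unitriangular p (bprod p A B)"
  using unit_band_bprod[of p 0 A 0 B] by (simp add: lower_unitriangular_iff_unit_band)

section \<open>Block triangular inverses\<close>

text \<open>Forward substitution: the \<open>i\<close>-th block row of \<open>S L = I\<close>,
  solved for \<open>L i j\<close> under the assumption that \<open>S i i\<close> is the
  identity.\<close>

fun lower_inv :: "nat \<Rightarrow> bmat \<Rightarrow> bmat" where
  "lower_inv p S i j =
     mat p p (\<lambda>(a, b). (if i = j \<and> a = b then 1 else 0)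
       - (\<Sum>k<i. \<Sum>c<p. S i k $$ (a, c) * lower_inv p S k j $$ (c, b)))"

declare lower_inv.simps [simp del]

lemma lower_unitriangular_lower_inv:
  assumes S: "lower_unitriangular p S"
  shows "lower_unitriangular p (lower_inv p S)"
proof -
  have 1: "lower_inv p S i j = (if i = j then 1\<^sub>m p else 0\<^sub>m p p)" if "i \<le> j" for i j
    using that
  proof (induction i rule: less_induct)
    case (less i)
    then have "lower_inv p S k j = 0\<^sub>m p p" if "k < i" for k using that by simp
    then show ?case
      by (subst lower_inv.simps, intro eq_matI) auto
  qed
  have "is_bmat p (lower_inv p S)"
    unfolding is_bmat_def by (intro allI, subst lower_inv.simps, rule mat_carrier)
  then show ?thesis unfolding lower_unitriangular_def using 1 by simp
qed

lemma bprod_lower_inv: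
  assumes S: "lower_unitriangular p S"
  shows "bprod p S (lower_inv p S) = bone p"
proof (rule bmat_eqI)
  let ?L = "lower_inv p S"
  have L: "is_bmat p ?L" using lower_unitriangular_lower_inv[OF S] by simp
  fix i j a b assume ab: "a < p" "b < p"
  have "bprod p S ?L i j $$ (a, b) = (\<Sum>k<Suc i. \<Sum>c<p. S i k $$ (a, c) * ?L k j $$ (c, b))"
    using S L ab by (intro bprod_finite) (auto simp: Suc_le_eq)
  also have "\<dots> = (\<Sum>k<i. \<Sum>c<p. S i k $$ (a, c) * ?L k j $$ (c, b)) + (1\<^sub>m p * ?L i j) $$ (a, b)"
    using S L ab by (subst index_mult_square[where p=p]) (auto simp: Suc_le_eq)
  also have "(1\<^sub>m p * ?L i j) = ?L i j" using L by simp
  \<comment> \<open>Unfolding only the isolated block \<open>?L i j\<close> produces the same sum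
    with opposite sign.\<close>
  also have "(\<Sum>k<i. \<Sum>c<p. S i k $$ (a, c) * ?L k j $$ (c, b)) + ?L i j $$ (a, b) = 
    bone p i j $$ (a, b)"
    using ab by (subst (2) lower_inv.simps) (simp add: bone_def bdiag_def)
  finally show "bprod p S ?L i j $$ (a, b) = bone p i j $$ (a, b)" .
qed simp_all

text \<open>The right inverse \<open>?L\<close> has a right inverse \<open>?K\<close> of its own,
  and associativity gives \<open>S = S (?L ?K) = (S ?L) ?K = ?K\<close>.\<close>

lemma lower_inv_bprod:
  assumes S: "lower_unitriangular p S"
  shows "bprod p (lower_inv p S) S = bone p"
proof -
  let ?L = "lower_inv p S" and ?K = "lower_inv p (lower_inv p S)"
  have L: "lower_unitriangular p ?L" by (rule lower_unitriangular_lower_inv[OF S])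
  have K: "lower_unitriangular p ?K" by (rule lower_unitriangular_lower_inv[OF L])
  have "S = bprod p S (bprod p ?L ?K)" using S by (simp add: bprod_lower_inv[OF L])
  also have "\<dots> = bprod p (bprod p S ?L) ?K"
    using S L K by (intro bprod_assoc bprod_defined_row_finite) auto
  also have "\<dots> = ?K" using K by (simp add: bprod_lower_inv[OF S])
  finally show ?thesis using bprod_lower_inv[OF L] by simp
qed

text \<open>The usual \<open>C = (B A) C = B (A C) = B\<close>, for a competitor \<open>C\<close>
  about which no finiteness is known. The alternative with transposes serves upper triangular
  matrices, whose rows are infinite but whose columns are finite.\<close>

lemma binv_eqI:
  assumes AB: "is_binverse p A B" and A: "is_bmat p A" 
    and fin: "row_finite p A \<and> row_finite p B \<or> row_finite p (btranspose A) \<and> row_finite p (btranspose B)"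
  shows "binv p A = B"
  unfolding binv_def
proof (rule the_equality, rule AB)
  fix C assume AC: "is_binverse p A C"
  have B: "is_bmat p B" and C: "is_bmat p C" using AB AC by (auto simp: is_binverse_def)
  from fin show "C = B"
  proof
    assume f: "row_finite p A \<and> row_finite p B"
    have "C = bprod p (bprod p B A) C" using AB C by (simp add: is_binverse_def)
    also have "\<dots> = bprod p B (bprod p A C)" 
      using f A C AC by (intro bprod_assoc[symmetric]) (auto simp: is_binverse_def)
    also have "\<dots> = B" using AC B by (simp add: is_binverse_def)
    finally show ?thesis .
  next
    assume f: "row_finite p (btranspose A) \<and> row_finite p (btranspose B)"
    let ?A = "btranspose A" and ?B = "btranspose B" and ?C = "btranspose C"
    have CA: "bprod p ?A ?C = bone p" and BA: "bprod p ?B ?A = bone p"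
      using AB AC A B C by (simp_all add: is_binverse_def btranspose_bprod[symmetric])
    have "?C = bprod p (bprod p ?B ?A) ?C" using C BA by simp
    also have "\<dots> = bprod p ?B (bprod p ?A ?C)"
      using f A C by (intro bprod_assoc[symmetric] bprod_defined_row_finite) auto
    also have "\<dots> = ?B" using B CA by simp
    finally show ?thesis by (metis btranspose_btranspose)
  qed
qed

lemma binv_lower_unitriangular:
  assumes S: "lower_unitriangular p S"
  shows "binv p S = lower_inv p S"
proof (rule binv_eqI)
  have L: "lower_unitriangular p (lower_inv p S)" by (rule lower_unitriangular_lower_inv[OF S])
  show "is_binverse p S (lower_inv p S)"
    using S L by (auto simp: is_binverse_def bprod_lower_inv lower_inv_bprod 
        intro!: bprod_defined_row_finite)
  show "row_finite p S \<and> row_finite p (lower_inv p S) \<or>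
    row_finite p (btranspose S) \<and> row_finite p (btranspose (lower_inv p S))"
    using S L by auto
qed (use S in simp)

section \<open>Block Toeplitz matrices and the Toda flows\<close>

text \<open>This is \<open>f(\<Lambda>)\<close> for a formal power series \<open>f\<close> with
  scalar coefficients. The flow matrices have this form, so their algebra reduces to that of power
  series.\<close>

definition toep :: "nat \<Rightarrow> real fps \<Rightarrow> bmat" where
  "toep p f = (\<lambda>i j. if i \<le> j then fps_nth f (j - i) \<cdot>\<^sub>m 1\<^sub>m p else 0\<^sub>m p p)"

lemma is_bmat_toep [simp]: "is_bmat p (toep p f)"
  by (simp add: is_bmat_def toep_def)

lemma dim_toep [simp]: "dim_row (toep p f i j) = p" "dim_col (toep p f i j) = p"
  by (simp_all add: toep_def)

lemma toep_index:
  "a < p \<Longrightarrow> b < p \<Longrightarrow> toep p f i j $$ (a, b) = (if i \<le> j \<and> a = b then fps_nth f (j - i) else 0)"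
  by (simp add: toep_def)

lemma row_finite_btranspose_toep [simp]: "row_finite p (btranspose (toep p f))"
proof -
  have "\<exists>r. \<forall>k\<ge>r. btranspose (toep p f) i k = 0\<^sub>m p p" for i
    by (rule exI[of _ "Suc i"]) (auto simp: btranspose_def toep_def)
  then show ?thesis by (simp add: row_finite_def)
qed

lemma toep_mult_index:
  assumes "B \<in> carrier_mat p p" "a < p" "b < p"
  shows "(toep p f i k * B) $$ (a, b) = (if i \<le> k then fps_nth f (k - i) * B $$ (a, b) else 0)"
proof -
  have "(toep p f i k * B) $$ (a, b) = (\<Sum>c<p. toep p f i k $$ (a, c) * B $$ (c, b))"
    using assms by (intro index_mult_square) simp_all
  also have "\<dots> = (\<Sum>c<p. if c = a then (if i \<le> k then fps_nth f (k - i) * B $$ (a, b) else 0) else 0)"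
    using assms by (intro sum.cong) (auto simp: toep_index)
  finally show ?thesis using assms by simp
qed

text \<open>Only \<open>i \<le> k \<le> j\<close> contributes, and translating \<open>k\<close> by
  \<open>i\<close> turns the sum into the Cauchy product of the coefficients.\<close>

lemma bprod_toep: "bprod p (toep p f) (toep p g) = toep p (f * g)"
proof (rule bmat_eqI)
  fix i j a b assume ab: "a < p" "b < p"
  let ?h = "\<lambda>k. if i \<le> k \<and> k \<le> j \<and> a = b then fps_nth f (k - i) * fps_nth g (j - k) else 0"
  have "bprod p (toep p f) (toep p g) i j $$ (a, b) = (\<Sum>k. ?h k)"
    using ab by (auto simp: bprod_def toep_mult_index toep_index intro!: suminf_cong)
  also have "\<dots> = (\<Sum>k\<in>{i..j}. ?h k)" by (intro suminf_finite) auto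
  also have "\<dots> = toep p (f * g) i j $$ (a, b)"
  proof (cases "i \<le> j \<and> a = b")
    case True
    then have "(\<Sum>k\<in>{i..j}. ?h k) = (\<Sum>k=0..j-i. fps_nth f k * fps_nth g (j - i - k))"
      by (intro sum.reindex_bij_witness[where i="\<lambda>k. k + i" and j="\<lambda>k. k - i"]) auto
    with True ab show ?thesis by (simp add: toep_index fps_mult_nth)
  qed (use ab in \<open>auto simp: toep_index\<close>)
  finally show "bprod p (toep p f) (toep p g) i j $$ (a, b) = toep p (f * g) i j $$ (a, b)" .
qed simp_all

lemma bone_eq_toep: "bone p = toep p 1"
proof (rule bmat_eqI[of p])
  fix i j a b assume "a < p" "b < p"
  then show "bone p i j $$ (a, b) = toep p 1 i j $$ (a, b)"
    by (auto simp: bone_def bdiag_def toep_index)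
qed simp_all

lemma bshift_eq_toep: "bshift p = toep p fps_X"
proof (rule bmat_eqI)
  show "is_bmat p (bshift p)" by (simp add: bshift_def is_bmat_def)
qed (auto simp: bshift_def toep_index)

lemma bpow_toep: "bpow p (toep p f) n = toep p (f ^ n)"
  by (induction n) (simp_all add: bone_eq_toep bprod_toep)

text \<open>Entrywise both sides are the same \<open>suminf\<close>, so the equality holds whether
  or not the series converge.\<close>

lemma bseries_toep:
  "bseries p (\<lambda>n. bscale (c n) (toep p (f n))) = toep p (Abs_fps (\<lambda>d. \<Sum>n. c n * fps_nth (f n) d))"
proof (rule bmat_eqI)
  show "is_bmat p (bseries p (\<lambda>n. bscale (c n) (toep p (f n))))"
    by (simp add: bseries_def is_bmat_def)
  fix i j a b assume ab: "a < p" "b < p"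
  have "bscale (c n) (toep p (f n)) i j $$ (a, b) 
      = (if i \<le> j \<and> a = b then c n * fps_nth (f n) (j - i) else 0)" for n
    using ab by (simp add: bscale_def toep_index)
  then show "bseries p (\<lambda>n. bscale (c n) (toep p (f n))) i j $$ (a, b) =
      toep p (Abs_fps (\<lambda>d. \<Sum>n. c n * fps_nth (f n) d)) i j $$ (a, b)"
    using ab by (cases "i \<le> j \<and> a = b") (auto simp: bseries_def toep_index)
qed simp

text \<open>The symbol \<open>g\<close> is the coefficientwise exponential of the series
  \<open>T\<close> of the times. Its constant coefficient is \<open>exp\<close> of a real number, so
  \<open>g\<close> is invertible as a formal power series.\<close>

lemma toda_wave_eq_toep:
  obtains g where "toda_wave p t = toep p g" "fps_nth g 0 \<noteq> 0"
proof
  define T where "T = Abs_fps (\<lambda>d. \<Sum>n. t n * fps_nth (fps_X ^ n) d)"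
  define g where "g = Abs_fps (\<lambda>d. \<Sum>n. (1 / fact n) * fps_nth (T ^ n) d)"
  show "toda_wave p t = toep p g"
    unfolding toda_wave_def bexp_def bshift_eq_toep bpow_toep bseries_toep T_def g_def ..
  have "fps_nth g 0 = exp (fps_nth T 0)"
    by (simp add: g_def exp_def fps_power_zeroth divide_inverse mult.commute)
  then show "fps_nth g 0 \<noteq> 0" by simp
qed

lemma bprod_defined_col_finite:
  assumes "is_bmat p A" "row_finite p (btranspose B)"
  shows "bprod_defined p A B"
  unfolding bprod_defined_def
proof (intro allI impI)
  fix i j a b assume ab: "a < p" "b < p"
  obtain r where "\<forall>k\<ge>r. btranspose B j k = 0\<^sub>m p p" 
    using assms(2) unfolding row_finite_def by blast
  then have "B k j = 0\<^sub>m p p" if "k \<ge> r" for k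
    using that unfolding btranspose_def by (metis transpose_transpose zero_transpose_mat)
  moreover have "is_bmat p B" using assms(2) by (metis btranspose_btranspose is_bmat_btranspose row_finite_is_bmat)
  ultimately show "summable (\<lambda>k. (A i k * B k j) $$ (a, b))"
    using assms ab by (intro bprod_finite(1)[where r=r]) auto
qed

text \<open>\<open>binv\<close> is a definite description, so even the shape of its value is known
  only once an inverse has been exhibited and shown to be unique; it is the Toeplitz matrix of
  \<open>inverse g\<close>.\<close>

lemma is_bmat_binv_toda_wave [simp]: "is_bmat p (binv p (toda_wave p t))"
proof -
  obtain g where g: "toda_wave p t = toep p g" "fps_nth g 0 \<noteq> 0" by (rule toda_wave_eq_toep)
  have "is_binverse p (toep p g) (toep p (inverse g))"
    using g(2) by (simp add: is_binverse_def bprod_toep inverse_mult_eq_1 inverse_mult_eq_1' 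
        bone_eq_toep bprod_defined_col_finite)
  then have "binv p (toep p g) = toep p (inverse g)"
    by (rule binv_eqI) auto
  with g show ?thesis by simp
qed

section \<open>The matrix \<open>W(\<Lambda>)\<close> and its commutation with the flows\<close>

lemma mpoly_coeff_carrier [simp]:
  "W \<in> carrier_mat p p \<Longrightarrow> mpoly_coeff W j \<in> carrier_mat p p"
  by (simp add: mpoly_coeff_def)

lemma is_bmat_mpoly_at_shift [simp]: "is_bmat p (mpoly_at_shift p W)"
  by (simp add: mpoly_at_shift_def bseries_def is_bmat_def)

text \<open>The \<open>j\<close>-th power of the shift lives on the \<open>j\<close>-th
  superdiagonal, so at most the term \<open>j = k - i\<close> of the series contributes to the block
  \<open>(i, k)\<close>.\<close>

lemma mpoly_at_shift_eq:
  assumes W: "W \<in> carrier_mat p p"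
  shows "mpoly_at_shift p W = (\<lambda>i j. if i \<le> j then mpoly_coeff W (j - i) else 0\<^sub>m p p)"
proof (rule bmat_eqI)
  show "is_bmat p (mpoly_at_shift p W)" by simp
  show "is_bmat p (\<lambda>i j. if i \<le> j then mpoly_coeff W (j - i) else 0\<^sub>m p p)" 
    using W by (simp add: is_bmat_def)
  fix i k a b assume ab: "a < p" "b < p"
  have [simp]: "(1::real) \<cdot>\<^sub>m 1\<^sub>m p = 1\<^sub>m p" "(0::real) \<cdot>\<^sub>m 1\<^sub>m p = 0\<^sub>m p p"
    by (intro eq_matI; simp)+
  have [simp]: "mpoly_coeff W j * 1\<^sub>m p = mpoly_coeff W j" "mpoly_coeff W j * 0\<^sub>m p p = 0\<^sub>m p p" for j
    using W right_mult_one_mat[of "mpoly_coeff W j" p p] right_mult_zero_mat[of "mpoly_coeff W j" p p p] by auto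
  have "bprod p (bdiag p (\<lambda>_. mpoly_coeff W j)) (bpow p (bshift p) j) i k 
      = (if i \<le> k \<and> j = k - i then mpoly_coeff W j else 0\<^sub>m p p)" for j
    unfolding bshift_eq_toep bpow_toep bprod_bdiag_left[OF is_bmat_toep mpoly_coeff_carrier[OF W]]
    by (auto simp: toep_def)
  then have "mpoly_at_shift p W i k $$ (a, b) 
      = (\<Sum>j. (if i \<le> k \<and> j = k - i then mpoly_coeff W j else 0\<^sub>m p p) $$ (a, b))"
    using ab by (simp add: mpoly_at_shift_def bseries_def)
  also have "\<dots> = (\<Sum>j\<in>{k - i}. (if i \<le> k \<and> j = k - i then mpoly_coeff W j else 0\<^sub>m p p) $$ (a, b))"
    using ab by (intro suminf_finite) auto
  finally show "mpoly_at_shift p W i k $$ (a, b) = 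
      (if i \<le> k then mpoly_coeff W (k - i) else 0\<^sub>m p p) $$ (a, b)" by simp
qed

lemma unit_band_mpoly_at_shift:
  assumes "monic_mpoly p N W"
  shows "unit_band p N (mpoly_at_shift p W)"
  using assms by (auto simp: unit_band_def mpoly_at_shift_eq monic_mpoly_def is_bmat_def)

lemma bprod_mpoly_at_shift:
  assumes W: "monic_mpoly p N W" and M: "is_bmat p M" and ab: "a < p" "b < p"
  shows "bprod p (mpoly_at_shift p W) M l j $$ (a, b) 
    = (\<Sum>d\<le>N. \<Sum>c<p. mpoly_coeff W d $$ (a, c) * M (l + d) j $$ (c, b))"
proof -
  note U = unit_band_mpoly_at_shift[OF W]
  have W': "W \<in> carrier_mat p p" using W by (simp add: monic_mpoly_def)
  let ?W = "mpoly_at_shift p W"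
  have "bprod p ?W M l j $$ (a, b) = (\<Sum>k<Suc (l + N). \<Sum>c<p. ?W l k $$ (a, c) * M k j $$ (c, b))"
    using U M ab by (intro bprod_finite) (auto simp: unit_bandD[OF U] Suc_le_eq)
  also have "\<dots> = (\<Sum>k\<in>{l..l + N}. \<Sum>c<p. ?W l k $$ (a, c) * M k j $$ (c, b))"
    using ab by (intro sum.mono_neutral_right) (auto simp: mpoly_at_shift_eq[OF W'])
  also have "\<dots> = (\<Sum>d\<le>N. \<Sum>c<p. mpoly_coeff W d $$ (a, c) * M (l + d) j $$ (c, b))"
    by (rule sum.reindex_bij_witness[where i="\<lambda>k. l + k" and j="\<lambda>k. k - l"])
       (auto simp: mpoly_at_shift_eq[OF W'])
  finally show ?thesis .
qed

text \<open>Both matrices are block Toeplitz and the coefficients of \<open>f\<close> are scalars,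
  hence commute with those of \<open>W\<close>. The rows of \<open>toep p f\<close> may be infinite,
  so instead of associativity the finite sum over the coefficients of \<open>W\<close> is pulled out
  of the convergent series.\<close>

lemma bprod_toep_mpoly_at_shift:
  assumes W: "monic_mpoly p N W" and M: "is_bmat p M" and def: "bprod_defined p (toep p f) M"
  shows "bprod p (toep p f) (bprod p (mpoly_at_shift p W) M) 
    = bprod p (mpoly_at_shift p W) (bprod p (toep p f) M)"
proof (rule bmat_eqI)
  fix i j a b assume ab: "a < p" "b < p"
  let ?f = "\<lambda>i l. if i \<le> l then fps_nth f (l - i) else 0"
  let ?A = "mpoly_coeff W"
  have s: "summable (\<lambda>l. ?f i l * M l j $$ (c, b))" if "c < p" for i c
  proof -
    have "(toep p f i l * M l j) $$ (c, b) = ?f i l * M l j $$ (c, b)" for l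
      using M that ab by (simp add: toep_mult_index)
    moreover have "summable (\<lambda>l. (toep p f i l * M l j) $$ (c, b))"
      using def that ab unfolding bprod_defined_def by blast
    ultimately show ?thesis by (simp only:)
  qed
  \<comment> \<open>A Toeplitz entry depends only on the difference of its indices, so
    \<open>W(\<Lambda>)\<close> acts by moving to row \<open>i + d\<close> of the product.\<close>
  have shift: "(\<lambda>l. ?f i l * M (l + d) j $$ (c, b)) = (\<lambda>l. ?f (i + d) (l + d) * M (l + d) j $$ (c, b))" for d c
    by auto
  have s': "summable (\<lambda>l. ?f i l * M (l + d) j $$ (c, b))" if "c < p" for d c
    using s[OF that, of "i + d"] unfolding shift by (subst summable_iff_shift)
  have eq: "(\<Sum>l. ?f i l * M (l + d) j $$ (c, b)) = bprod p (toep p f) M (i + d) j $$ (c, b)"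
    if "c < p" for d c
  proof -
    have "bprod p (toep p f) M (i + d) j $$ (c, b) = (\<Sum>l. ?f (i + d) l * M l j $$ (c, b))"
      using M ab that by (auto simp: bprod_def toep_mult_index intro!: suminf_cong)
    also have "\<dots> = (\<Sum>l. ?f (i + d) (l + d) * M (l + d) j $$ (c, b)) 
        + (\<Sum>l<d. ?f (i + d) l * M l j $$ (c, b))"
      by (rule suminf_split_initial_segment[OF s[OF that]])
    \<comment> \<open>The initial segment lies strictly below the diagonal of row
      \<open>i + d\<close>.\<close>
    also have "(\<Sum>l<d. ?f (i + d) l * M l j $$ (c, b)) = 0"
      by (intro sum.neutral) auto
    finally show ?thesis unfolding shift by simp
  qed
  have "bprod p (toep p f) (bprod p (mpoly_at_shift p W) M) i j $$ (a, b)
      = (\<Sum>l. ?f i l * (\<Sum>d\<le>N. \<Sum>c<p. ?A d $$ (a, c) * M (l + d) j $$ (c, b)))"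
    using ab M W by (auto simp: bprod_def[of p "toep p f"] toep_mult_index bprod_mpoly_at_shift intro!: suminf_cong)
  also have "\<dots> = (\<Sum>l. \<Sum>d\<le>N. \<Sum>c<p. ?A d $$ (a, c) * (?f i l * M (l + d) j $$ (c, b)))"
    by (simp only: sum_distrib_left mult.left_commute)
  also have "\<dots> = (\<Sum>d\<le>N. \<Sum>l. \<Sum>c<p. ?A d $$ (a, c) * (?f i l * M (l + d) j $$ (c, b)))"
    using s' by (intro suminf_sum summable_sum summable_mult) auto
  also have "\<dots> = (\<Sum>d\<le>N. \<Sum>c<p. \<Sum>l. ?A d $$ (a, c) * (?f i l * M (l + d) j $$ (c, b)))"
    using s' by (intro sum.cong refl suminf_sum summable_mult) auto
  also have "\<dots> = (\<Sum>d\<le>N. \<Sum>c<p. ?A d $$ (a, c) * (\<Sum>l. ?f i l * M (l + d) j $$ (c, b)))"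
    using s' by (intro sum.cong refl suminf_mult) auto
  also have "\<dots> = (\<Sum>d\<le>N. \<Sum>c<p. ?A d $$ (a, c) * bprod p (toep p f) M (i + d) j $$ (c, b))"
    using eq by (intro sum.cong refl) auto
  also have "\<dots> = bprod p (mpoly_at_shift p W) (bprod p (toep p f) M) i j $$ (a, b)"
    using ab W by (simp add: bprod_mpoly_at_shift)
  finally show "bprod p (toep p f) (bprod p (mpoly_at_shift p W) M) i j $$ (a, b)
    = bprod p (mpoly_at_shift p W) (bprod p (toep p f) M) i j $$ (a, b)" .
qed simp_all

text \<open>After the commutation with the first flow, \<open>W(\<Lambda>)\<close> is a row finite
  leftmost factor, so associativity applies; the convergence it asks for is part of
  \<open>toda_defined\<close>.\<close>

lemma toda_evolve_mpoly_at_shift: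
  assumes W: "monic_mpoly p N W" and M: "is_bmat p M" and def: "toda_defined p t1 t2 M"
  shows "toda_evolve p t1 t2 (bprod p (mpoly_at_shift p W) M)
    = bprod p (mpoly_at_shift p W) (toda_evolve p t1 t2 M)"
proof -
  obtain g where g: "toda_wave p t1 = toep p g" by (rule toda_wave_eq_toep)
  have "toda_evolve p t1 t2 (bprod p (mpoly_at_shift p W) M)
      = bprod p (bprod p (mpoly_at_shift p W) (bprod p (toda_wave p t1) M)) 
          (btranspose (binv p (toda_wave p t2)))"
    using bprod_toep_mpoly_at_shift[OF W M] def g by (simp add: toda_evolve_def toda_defined_def)
  also have "\<dots> = bprod p (mpoly_at_shift p W) (toda_evolve p t1 t2 M)"
    unfolding toda_evolve_def using W def
    by (intro bprod_assoc[symmetric]) 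
       (auto intro: unit_band_row_finite unit_band_mpoly_at_shift simp: toda_defined_def)
  finally show ?thesis .
qed

section \<open>Linear algebra\<close>

text \<open>A nonzero determinant makes \<open>A\<close> a unit of the matrix ring, which excludes
  the case \<open>None\<close> under \<open>the\<close>.\<close>

lemma minv_inverse:
  assumes A: "A \<in> carrier_mat n n" and d: "det A \<noteq> 0"
  shows "minv A \<in> carrier_mat n n" "A * minv A = 1\<^sub>m n" "minv A * A = 1\<^sub>m n"
proof -
  have "A \<in> Units (ring_mat TYPE('a) n ())" by (rule det_non_zero_imp_unit[OF A d])
  then obtain B where "mat_inverse A = Some B" using mat_inverse(1)[OF A, of "()"] by (cases "mat_inverse A") auto
  with mat_inverse(2)[OF A this]
  show "minv A \<in> carrier_mat n n" "A * minv A = 1\<^sub>m n" "minv A * A = 1\<^sub>m n"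
    by (simp_all add: minv_def)
qed

lemma det_nonzero_of_invertible:
  assumes A: "A \<in> carrier_mat n n" and i: "invertible_mat A"
  shows "det (A :: 'a :: field mat) \<noteq> 0"
proof -
  obtain B where B: "A * B = 1\<^sub>m n" "B * A = 1\<^sub>m (dim_row B)"
    using A i unfolding invertible_mat_def inverts_mat_def by auto
  have "B \<in> carrier_mat n n" 
    using arg_cong[OF B(1), of dim_col] arg_cong[OF B(2), of dim_col] A by auto
  then have "det A * det B = 1" using det_mult[OF A] B by (metis det_one)
  then show ?thesis by auto
qed

lemma sum_lessThan_add: "(\<Sum>m<k + n. f m) = (\<Sum>m<k. f m) + (\<Sum>l<n. f (k + l))" 
  for f :: "nat \<Rightarrow> 'a :: comm_monoid_add"
  by (induction n) (simp_all add: add.assoc)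

lemma sum_block_rows:
  "(\<Sum>r<n * p. f (r div p) (r mod p)) = (\<Sum>l<n. \<Sum>d<p. f l d)" for f :: "nat \<Rightarrow> nat \<Rightarrow> 'a :: comm_monoid_add"
proof (cases "p = 0")
  case False
  have "(\<Sum>r<n * p. f (r div p) (r mod p)) = (\<Sum>l<n. \<Sum>r = l * p..<l * p + p. f (r div p) (r mod p))"
    by (rule sum.nat_group[symmetric])
  also have "\<dots> = (\<Sum>l<n. \<Sum>d<p. f l d)"
  proof (rule sum.cong[OF refl])
    fix l
    have "(\<Sum>r = l * p..<l * p + p. f (r div p) (r mod p)) = (\<Sum>d\<in>{..<p}. f ((l * p + d) div p) ((l * p + d) mod p))"
      by (rule sum.reindex_bij_witness[where i="\<lambda>d. l * p + d" and j="\<lambda>r. r - l * p"]) auto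
    also have "\<dots> = (\<Sum>d<p. f l d)" by (intro sum.cong) auto
    finally show "(\<Sum>r = l * p..<l * p + p. f (r div p) (r mod p)) = (\<Sum>d<p. f l d)" .
  qed
  finally show ?thesis .
qed simp

text \<open>If \<open>X A = - C\<close>, then \<open>D - C A\<^sup>-\<^sup>1 B = D + X B\<close>.\<close>

lemma last_quasidet_block_column:
  assumes p: "0 < p" and n: "0 < n"
    and R: "\<And>l. R l \<in> carrier_mat p m" and d: "det (block_column p n R) \<noteq> 0"
    and B: "\<And>l. B l \<in> carrier_mat p p" and C: "C \<in> carrier_mat p m" and D: "D \<in> carrier_mat p p"
    and X: "\<And>a c. a < p \<Longrightarrow> c < m \<Longrightarrow> C $$ (a, c) + (\<Sum>l<n. \<Sum>e<p. X l a e * R l $$ (e, c)) = 0"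
    and E: "E \<in> carrier_mat p p" 
    and eq: "\<And>a b. a < p \<Longrightarrow> b < p \<Longrightarrow> E $$ (a, b) = D $$ (a, b) + (\<Sum>l<n. \<Sum>e<p. X l a e * B l $$ (e, b))"
  shows "E = last_quasidet (block_column p n R) (block_column p n B) C D"
proof -
  let ?A = "block_column p n R" and ?B = "block_column p n B"
  \<comment> \<open>\<open>Y\<close> flattens the block coefficients \<open>X l\<close> into one
    matrix, with the row indexing of \<open>block_column\<close>.\<close>
  define Y where "Y = mat p (n * p) (\<lambda>(a, r). X (r div p) a (r mod p))"
  have carr: "?A \<in> carrier_mat (n * p) m" "?B \<in> carrier_mat (n * p) p" "Y \<in> carrier_mat p (n * p)"
    using R[of 0] B[of 0] by (auto simp: block_column_def Y_def)
  \<comment> \<open>\<open>det\<close> is \<open>0\<close> on non-square matrices, so the hypothesis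
    \<open>d\<close> itself forces the column count.\<close>
  have "m = n * p" using d carr(1) by (auto simp: det_def split: if_splits)
  with carr have A: "?A \<in> carrier_mat (n * p) (n * p)" by simp
  note inv = minv_inverse[OF A d]
  have idx: "r div p < n \<and> r mod p < p" if "r < n * p" for r
    using that p by (simp add: less_mult_imp_div_less)
  have prod: "(Y * block_column p n F) $$ (a, c) = (\<Sum>l<n. \<Sum>e<p. X l a e * F l $$ (e, c))"
    if "\<And>l. F l \<in> carrier_mat p k" "a < p" "c < k" for F a c k
  proof -
    have "(Y * block_column p n F) $$ (a, c) 
        = (\<Sum>r<n * p. X (r div p) a (r mod p) * F (r div p) $$ (r mod p, c))"
      using that carrier_matD(2)[OF that(1)[of 0]]
      by (auto simp: index_mult_mat(1) scalar_prod_def Y_def block_column_def atLeast0LessThan intro!: sum.cong)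
    then show ?thesis by (simp only: sum_block_rows[of "\<lambda>l e. X l a e * F l $$ (e, c)"])
  qed
  have "C = - (Y * ?A)"
  proof (rule eq_matI)
    fix a c assume "a < dim_row (- (Y * ?A))" "c < dim_col (- (Y * ?A))"
    then have ac: "a < p" "c < m" using carr by auto
    have "C $$ (a, c) = - (\<Sum>l<n. \<Sum>e<p. X l a e * R l $$ (e, c))"
      using X[OF ac] by (simp add: eq_neg_iff_add_eq_0)
    then show "C $$ (a, c) = (- (Y * ?A)) $$ (a, c)"
      using ac prod[OF R ac] carr by simp
  qed (use C carr in auto)
  then have "C * minv ?A = - (Y * ?A * minv ?A)"
    using carrier_matD[OF A] carrier_matD[OF inv(1)] by simp
  also have "Y * ?A * minv ?A = Y"
    using carr A inv by (simp add: assoc_mult_mat[of _ p "n * p" _ "n * p" _ "n * p"])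
  finally have "C * minv ?A * ?B = - (Y * ?B)" using carr by simp
  then have "last_quasidet ?A ?B C D = D - (- (Y * ?B))" by (simp add: last_quasidet_def)
  also have "\<dots> = E"
  proof (rule eq_matI)
    fix a b assume "a < dim_row E" "b < dim_col E"
    then have "a < p" "b < p" using E by auto
    then show "(D - (- (Y * ?B))) $$ (a, b) = E $$ (a, b)"
      using carr D by (simp add: prod[OF B] eq)
  qed (use carr D E in auto)
  finally show ?thesis by simp
qed

section \<open>The resolvent\<close>

lemma bprod_assoc_row_finite:
  "row_finite p A \<Longrightarrow> row_finite p B \<Longrightarrow> is_bmat p C \<Longrightarrow> 
    bprod p A (bprod p B C) = bprod p (bprod p A B) C"
  by (intro bprod_assoc bprod_defined_row_finite) auto

text \<open>\<open>U = S2 T2\<inverse>\<close> connects the second families as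
  \<open>\<omega>\<close> connects the first ones. The last clause is the equality of the two
  expressions of the resolvent, with \<open>H\<close> moved to the other side.\<close>

lemma block_gauss_resolvent:
  assumes W: "monic_mpoly p N W"
    and G: "block_gauss p M S1 H S2"
    and Gh: "block_gauss p (bprod p (mpoly_at_shift p W) M) T1 K T2"
  obtains \<omega> U where "unit_band p N \<omega>" "lower_unitriangular p U"
    "bprod p \<omega> S1 = bprod p T1 (mpoly_at_shift p W)"
    "bprod p U T2 = S2"
    "\<And>k j. \<omega> k j * H j = K k * transpose_mat (U j k)"
proof
  let ?W = "mpoly_at_shift p W" and ?L = "lower_inv p"
  let ?H = "bdiag p H" and ?K = "bdiag p K"
  have low: "lower_unitriangular p S1" "lower_unitriangular p S2" 
    "lower_unitriangular p T1" "lower_unitriangular p T2"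
    and H: "\<And>k. H k \<in> carrier_mat p p" and K: "\<And>k. K k \<in> carrier_mat p p"
    using G Gh by (auto simp: block_gauss_def)
  have M: "M = bprod p (bprod p (?L S1) ?H) (btranspose (?L S2))"
    and WM: "bprod p ?W M = bprod p (bprod p (?L T1) ?K) (btranspose (?L T2))"
    using G Gh by (simp_all add: block_gauss_def binv_lower_unitriangular)
  note linv = low[THEN lower_unitriangular_lower_inv]
  note rf = row_finite_lower_unitriangular[OF low(1)] row_finite_lower_unitriangular[OF low(2)]
    row_finite_lower_unitriangular[OF low(3)] row_finite_lower_unitriangular[OF low(4)]
    row_finite_lower_unitriangular[OF linv(1)] row_finite_lower_unitriangular[OF linv(2)]
    row_finite_lower_unitriangular[OF linv(3)] row_finite_lower_unitriangular[OF linv(4)]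
    row_finite_bdiag[of H, OF H] row_finite_bdiag[of K, OF K]
    unit_band_row_finite[OF unit_band_mpoly_at_shift[OF W]]
  note rules = rf row_finite_bprod row_finite_is_bmat is_bmat_btranspose
  define \<omega> where "\<omega> = bprod p (bprod p T1 ?W) (?L S1)"
  define U where "U = bprod p S2 (?L T2)"
  have rf_\<omega>: "row_finite p \<omega>" unfolding \<omega>_def by (intro rules)
  show "unit_band p N \<omega>"
    using unit_band_bprod[OF unit_band_bprod[OF _ unit_band_mpoly_at_shift[OF W]], of 0 T1 0 "?L S1"]
      low(3) linv(1) by (simp add: \<omega>_def lower_unitriangular_iff_unit_band)
  show "lower_unitriangular p U"
    unfolding U_def by (intro lower_unitriangular_bprod low linv)
  have "bprod p \<omega> S1 = bprod p (bprod p T1 ?W) (bprod p (?L S1) S1)"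
    unfolding \<omega>_def by (intro bprod_assoc_row_finite[symmetric] rules)
  then show "bprod p \<omega> S1 = bprod p T1 ?W" by (simp add: lower_inv_bprod low)
  have "bprod p U T2 = bprod p S2 (bprod p (?L T2) T2)"
    unfolding U_def by (intro bprod_assoc_row_finite[symmetric] rules)
  then show "bprod p U T2 = S2" by (simp add: lower_inv_bprod low)
  \<comment> \<open>Both sides equal \<open>T1 W(\<Lambda>) M\<close>, by the two
    factorisations.\<close>
  have "bprod p (bprod p \<omega> ?H) (btranspose (?L S2)) 
      = bprod p \<omega> (bprod p ?H (btranspose (?L S2)))"
    by (intro bprod_assoc_row_finite[symmetric] rules rf_\<omega>)
  also have "\<dots> = bprod p (bprod p T1 ?W) (bprod p (?L S1) (bprod p ?H (btranspose (?L S2))))"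
    unfolding \<omega>_def by (intro bprod_assoc_row_finite[symmetric] rules is_bmat_bprod)
  also have "bprod p (?L S1) (bprod p ?H (btranspose (?L S2))) = M"
    unfolding M by (intro bprod_assoc_row_finite rules)
  also have "bprod p (bprod p T1 ?W) M = bprod p T1 (bprod p ?W M)"
    unfolding M by (intro bprod_assoc_row_finite[symmetric] rules is_bmat_bprod)
  also have "\<dots> = bprod p (bprod p T1 (bprod p (?L T1) ?K)) (btranspose (?L T2))"
    unfolding WM by (intro bprod_assoc_row_finite rules)
  also have "bprod p T1 (bprod p (?L T1) ?K) = bprod p (bprod p T1 (?L T1)) ?K"
    by (intro bprod_assoc_row_finite rules)
  also have "\<dots> = ?K" using K by (simp add: bprod_lower_inv low)
  finally have eq: "bprod p (bprod p \<omega> ?H) (btranspose (?L S2)) = bprod p ?K (btranspose (?L T2))" .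
  \<comment> \<open>Now multiply by the transpose of \<open>S2\<close> on the right. Upper
    triangular factors have finite columns, so these products are defined, and the left factors
    \<open>\<omega> H\<close> and \<open>K\<close> are row finite.\<close>
  have "bprod p \<omega> ?H = bprod p (bprod p \<omega> ?H) (btranspose (bprod p S2 (?L S2)))"
    using low by (simp add: bprod_lower_inv)
  also have "\<dots> = bprod p (bprod p \<omega> ?H) (bprod p (btranspose (?L S2)) (btranspose S2))"
    using low linv by (simp add: btranspose_bprod)
  also have "\<dots> = bprod p (bprod p (bprod p \<omega> ?H) (btranspose (?L S2))) (btranspose S2)"
    by (intro bprod_assoc rules rf_\<omega> bprod_defined_col_finite) (simp add: rf)
  also have "\<dots> = bprod p (bprod p ?K (btranspose (?L T2))) (btranspose S2)" 
    unfolding eq ..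
  also have "\<dots> = bprod p ?K (bprod p (btranspose (?L T2)) (btranspose S2))"
    by (intro bprod_assoc[symmetric] rules bprod_defined_col_finite) (simp add: rf)
  also have "bprod p (btranspose (?L T2)) (btranspose S2) = btranspose U"
    unfolding U_def by (intro btranspose_bprod[symmetric] rules)
  finally have "bprod p \<omega> ?H = bprod p ?K (btranspose U)" .
  then have "(\<lambda>k j. \<omega> k j * H j) = (\<lambda>k j. K k * btranspose U k j)"
    using H K rf_\<omega> by (simp add: bprod_bdiag_left bprod_bdiag_right U_def)
  then show "\<omega> k j * H j = K k * transpose_mat (U j k)" for k j
    by (auto dest!: fun_cong simp: btranspose_def)
qed

section \<open>From matrix identities to identities of polynomials\<close>

lemma coeff_gauss_poly:
  assumes "lower_unitriangular p S" "a < p" "b < p"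
  shows "coeff (gauss_poly p S k $$ (a, b)) i = S k i $$ (a, b)"
proof -
  have "coeff (gauss_poly p S k $$ (a, b)) i = (\<Sum>j\<le>k. if j = i then S k j $$ (a, b) else 0)"
    using assms by (auto simp: gauss_poly_def coeff_sum intro!: sum.cong)
  also have "\<dots> = (if i \<le> k then S k i $$ (a, b) else 0)" by simp
  also have "\<dots> = S k i $$ (a, b)" using assms by auto
  finally show ?thesis .
qed

lemma gauss_poly_carrier [simp]: "gauss_poly p S k \<in> carrier_mat p p" 
  "dim_row (gauss_poly p S k) = p" "dim_col (gauss_poly p S k) = p"
  by (simp_all add: gauss_poly_def)

text \<open>Compares coefficients in \<open>(A S) \<chi>(x) = A (S \<chi>(x))\<close>; the band of
  \<open>A\<close> ends the sum at \<open>k + n\<close>.\<close>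

lemma gauss_poly_bprod:
  assumes A: "unit_band p n A" and S: "lower_unitriangular p S" and ab: "a < p" "b < p"
    and eq: "\<And>i. bprod p A S k i $$ (a, b) = coeff f i"
  shows "f = (\<Sum>j\<le>k + n. \<Sum>c<p. Polynomial.smult (A k j $$ (a, c)) (gauss_poly p S j $$ (c, b)))"
proof (rule poly_eqI)
  fix i
  have "coeff f i = (\<Sum>j<Suc (k + n). \<Sum>c<p. A k j $$ (a, c) * S j i $$ (c, b))"
    unfolding eq[symmetric] using S ab
    by (intro bprod_finite) (auto simp: unit_bandD[OF A] Suc_le_eq)
  then show "coeff f i = coeff (\<Sum>j\<le>k + n. \<Sum>c<p. Polynomial.smult (A k j $$ (a, c)) (gauss_poly p S j $$ (c, b))) i"
    using S ab by (simp add: coeff_sum coeff_gauss_poly lessThan_Suc_atMost)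
qed

text \<open>Coefficient form of \<open>W(\<Lambda>) \<chi>(x) = \<chi>(x) W(x)\<close>: the block
  \<open>(j, i)\<close> of \<open>W(\<Lambda>)\<close> is the coefficient of \<open>W\<close> of
  degree \<open>i - j\<close>.\<close>

lemma gauss_poly_mult_mpoly:
  assumes W: "W \<in> carrier_mat p p" and S: "lower_unitriangular p S" and ab: "a < p" "b < p"
  shows "coeff ((gauss_poly p S k * W) $$ (a, b)) i = bprod p S (mpoly_at_shift p W) k i $$ (a, b)"
proof -
  have zero: "mpoly_at_shift p W j i = 0\<^sub>m p p" if "Suc i \<le> j" for j
    using that W by (simp add: mpoly_at_shift_eq)
  have "(gauss_poly p S k * W) $$ (a, b) = (\<Sum>c<p. gauss_poly p S k $$ (a, c) * W $$ (c, b))"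
    using W ab by (intro index_mult_square) simp_all
  then have "coeff ((gauss_poly p S k * W) $$ (a, b)) i 
      = (\<Sum>c<p. \<Sum>j\<le>i. S k j $$ (a, c) * coeff (W $$ (c, b)) (i - j))"
    using S ab by (simp add: coeff_sum coeff_mult coeff_gauss_poly)
  also have "\<dots> = (\<Sum>j<Suc i. \<Sum>c<p. S k j $$ (a, c) * mpoly_at_shift p W j i $$ (c, b))"
    unfolding lessThan_Suc_atMost using W ab
    by (subst sum.swap) (auto simp: mpoly_at_shift_eq mpoly_coeff_def intro!: sum.cong)
  also have "\<dots> = bprod p S (mpoly_at_shift p W) k i $$ (a, b)"
    using S ab zero by (intro bprod_finite(2)[symmetric]) simp_all
  finally show ?thesis .
qed

section \<open>Jets along root polynomials\<close>

lemma dvd_power_pderiv: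
  fixes f :: "'a :: idom poly"
  assumes "[:- a, 1:] ^ Suc m dvd f"
  shows "[:- a, 1:] ^ m dvd pderiv f"
proof -
  define l where "l = [:- a, 1:]"
  have l: "pderiv l = 1" by (simp add: l_def pderiv_pCons)
  obtain h where "f = l ^ Suc m * h" using assms unfolding l_def by (elim dvdE)
  then have "pderiv f = l ^ m * (l * pderiv h + Polynomial.smult (of_nat (Suc m)) h)"
    by (simp only: pderiv_mult pderiv_power_Suc l) (simp add: algebra_simps del: of_nat_Suc)
  then show ?thesis unfolding l_def by (metis dvd_triv_left)
qed

lemma poly_higher_pderiv_eq_0:
  fixes f :: "'a :: idom poly"
  assumes "[:- a, 1:] ^ m dvd f" "r < m"
  shows "poly ((pderiv ^^ r) f) a = 0"
  using assms
proof (induction r arbitrary: f m)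
  case 0
  then have "[:- a, 1:] dvd f" by (metis dvd_power dvd_trans)
  then show ?case by (simp add: poly_eq_0_iff_dvd)
next
  case (Suc r)
  then obtain m' where m: "m = Suc m'" "r < m'" by (cases m) auto
  then have "poly ((pderiv ^^ r) (pderiv f)) a = 0"
    using Suc dvd_power_pderiv by blast
  then show ?case by (simp add: funpow_swap1)
qed

text \<open>Induction on \<open>m\<close>: in characteristic zero, differentiation lowers the order
  of a zero by exactly one, unless the polynomial is constant, and a constant with a zero is
  \<open>0\<close>.\<close>

lemma dvd_power_of_higher_pderiv:
  fixes f :: "'a :: field_char_0 poly"
  assumes "\<And>r. r < m \<Longrightarrow> poly ((pderiv ^^ r) f) a = 0"
  shows "[:- a, 1:] ^ m dvd f"
  using assms
proof (induction m arbitrary: f)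
  case (Suc m)
  have f0: "poly f a = 0" using Suc.prems[of 0] by simp
  show ?case
  proof (cases "pderiv f = 0")
    case True
    then obtain c where "f = [:c:]" by (metis pderiv_eq_0_iff degree_eq_zeroE)
    with f0 show ?thesis by simp
  next
    case False
    then have nz: "f \<noteq> 0" by auto
    have "[:- a, 1:] ^ m dvd pderiv f"
    proof (rule Suc.IH)
      show "poly ((pderiv ^^ r) (pderiv f)) a = 0" if "r < m" for r
        using Suc.prems[of "Suc r"] that by (simp add: funpow_swap1)
    qed
    then have "m \<le> order a (pderiv f)" using False by (simp add: order_divides)
    moreover have "order a f = Suc (order a (pderiv f))"
      using False f0 nz by (intro order_pderiv) (auto simp: order_root)
    ultimately have "Suc m \<le> order a f" by simp
    then show ?thesis using order_divides by blast
  qed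
qed simp

lemma poly_higher_pderiv_linear_power:
  fixes a :: "'a :: field_char_0"
  shows "poly ((pderiv ^^ n) ([:- a, 1:] ^ k)) a = (if n = k then fact k else 0)"
proof (induction n arbitrary: k)
  case 0
  then show ?case by (cases k) simp_all
next
  case (Suc n)
  show ?case
  proof (cases k)
    case 0
    then show ?thesis by (simp add: funpow_swap1)
  next
    case (Suc k')
    have "pderiv ([:- a, 1:] ^ Suc k') = Polynomial.smult (of_nat (Suc k')) ([:- a, 1:] ^ k')"
      by (simp only: pderiv_power_Suc) (simp add: pderiv_pCons del: of_nat_Suc)
    then have "(pderiv ^^ Suc n) ([:- a, 1:] ^ k) 
        = Polynomial.smult (of_nat (Suc k')) ((pderiv ^^ n) ([:- a, 1:] ^ k'))"
      by (simp only: funpow_Suc_right o_apply Suc higher_pderiv_smult)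
    then show ?thesis using Suc.IH[of k'] Suc by simp
  qed
qed

text \<open>The truncation has the same derivatives at \<open>x0\<close> as \<open>u\<close> in all
  orders below \<open>m\<close>.\<close>

lemma dvd_diff_taylor_truncate:
  assumes "a < dim_vec u"
  shows "[:- x0, 1:] ^ m dvd (taylor_truncate x0 m u $ a - u $ a)"
proof (rule dvd_power_of_higher_pderiv)
  fix r assume r: "r < m"
  let ?c = "\<lambda>k. poly ((pderiv ^^ k) (u $ a)) x0 / fact k"
  have "taylor_truncate x0 m u $ a - u $ a
      = (\<Sum>k<m. Polynomial.smult (?c k) ([:- x0, 1:] ^ k)) + Polynomial.smult (- 1) (u $ a)"
    using assms by (simp add: taylor_truncate_def)
  then have "(pderiv ^^ r) (taylor_truncate x0 m u $ a - u $ a)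
      = (\<Sum>k<m. Polynomial.smult (?c k) ((pderiv ^^ r) ([:- x0, 1:] ^ k))) 
        + Polynomial.smult (- 1) ((pderiv ^^ r) (u $ a))"
    by (simp only: higher_pderiv_add higher_pderiv_sum higher_pderiv_smult)
  then have "poly ((pderiv ^^ r) (taylor_truncate x0 m u $ a - u $ a)) x0
      = (\<Sum>k<m. ?c k * (if r = k then fact k else 0)) - poly ((pderiv ^^ r) (u $ a)) x0"
    by (simp add: poly_sum poly_higher_pderiv_linear_power)
  also have "(\<Sum>k<m. ?c k * (if r = k then fact k else 0)) 
      = (\<Sum>k<m. if k = r then poly ((pderiv ^^ k) (u $ a)) x0 else 0)"
    by (intro sum.cong) auto
  finally show "poly ((pderiv ^^ r) (taylor_truncate x0 m u $ a - u $ a)) x0 = 0" using r by simp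
qed

section \<open>Order of vanishing of \<open>W v\<close> for root polynomials and their
  truncations\<close>

lemma mult_mat_vec_index:
  assumes "A \<in> carrier_mat p p" "v \<in> carrier_vec p" "a < p"
  shows "(A *\<^sub>v v) $ a = (\<Sum>b<p. A $$ (a, b) * v $ b)"
  using assms by (simp add: scalar_prod_def atLeast0LessThan)

text \<open>Multiplication by the adjugate turns \<open>W v = 0\<close> into \<open>det W\<close>
  times \<open>v\<close> being zero. This works over the polynomial ring, where \<open>W\<close>
  need not have an inverse.\<close>

lemma mult_mat_vec_nonzero:
  fixes W :: "'a :: idom mat"
  assumes W: "W \<in> carrier_mat p p" and d: "det W \<noteq> 0" and v: "v \<in> carrier_vec p" "v \<noteq> 0\<^sub>v p"
  shows "W *\<^sub>v v \<noteq> 0\<^sub>v p"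
proof
  assume "W *\<^sub>v v = 0\<^sub>v p"
  then have "(adj_mat W * W) *\<^sub>v v = 0\<^sub>v p"
    using adj_mat(1)[OF W] W v by (subst assoc_mult_mat_vec[of _ p p _ p]) auto
  then have "(det W \<cdot>\<^sub>m 1\<^sub>m p) *\<^sub>v v = 0\<^sub>v p" using adj_mat(3)[OF W] by simp
  then have z: "((det W \<cdot>\<^sub>m 1\<^sub>m p) *\<^sub>v v) $ a = 0" if "a < p" for a using that by simp
  have "v $ a = 0" if a: "a < p" for a
  proof -
    have "0 = (\<Sum>b<p. (det W \<cdot>\<^sub>m 1\<^sub>m p) $$ (a, b) * v $ b)"
      by (rule trans[OF z[OF a, symmetric] mult_mat_vec_index]) (use a v in auto)
    also have "\<dots> = (\<Sum>b<p. if b = a then det W * v $ a else 0)"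
      using a by (intro sum.cong) auto
    finally show ?thesis using a d by simp
  qed
  with v show False by (metis eq_vecI carrier_vecD index_zero_vec)
qed

text \<open>The maximum in \<^const>\<open>zero_order\<close> is attained only because \<open>W u \<noteq> 0\<close>.\<close>

lemma root_order_dvd:
  assumes W: "W \<in> carrier_mat p p" and d: "det W \<noteq> 0" and u: "root_poly p W x0 u" and a: "a < p"
  shows "[:- x0, 1:] ^ root_order W x0 u dvd (W *\<^sub>v u) $ a"
proof -
  let ?S = "{m. \<forall>a<dim_vec (W *\<^sub>v u). [:- x0, 1:] ^ m dvd (W *\<^sub>v u) $ a}"
  have u': "u \<in> carrier_vec p" "u \<noteq> 0\<^sub>v p"
    using u by (auto simp: root_poly_def vec_at_def)
  have "W *\<^sub>v u \<noteq> 0\<^sub>v p" by (rule mult_mat_vec_nonzero[OF W d u'])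
  then obtain b where b: "b < p" "(W *\<^sub>v u) $ b \<noteq> 0"
    using W by (metis carrier_matD(1) dim_mult_mat_vec eq_vecI index_zero_vec)
  then have "?S \<subseteq> {..order x0 ((W *\<^sub>v u) $ b)}"
    using W by (auto simp: order_divides)
  then have "finite ?S" by (rule finite_subset) simp
  moreover have "0 \<in> ?S" by simp
  then have "?S \<noteq> {}" by blast
  ultimately have "zero_order x0 (W *\<^sub>v u) \<in> ?S"
    unfolding zero_order_def by (rule Max_in)
  then show ?thesis using a W by (auto simp: root_order_def)
qed

lemma taylor_truncate_carrier: "u \<in> carrier_vec p \<Longrightarrow> taylor_truncate x0 m u \<in> carrier_vec p"
  by (simp add: taylor_truncate_def)

text \<open>The jets use the truncated polynomials. Truncating at the order changes \<open>u\<close>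
  only by multiples of that power of \<open>x - x0\<close>, so the vanishing of \<open>W u\<close>
  is inherited.\<close>

lemma root_order_dvd_taylor_truncate:
  assumes W: "W \<in> carrier_mat p p" and d: "det W \<noteq> 0" and u: "root_poly p W x0 u" and a: "a < p"
  shows "[:- x0, 1:] ^ root_order W x0 u dvd (W *\<^sub>v taylor_truncate x0 (root_order W x0 u) u) $ a"
proof -
  let ?m = "root_order W x0 u"
  have u': "u \<in> carrier_vec p" using u by (auto simp: root_poly_def)
  have "(W *\<^sub>v taylor_truncate x0 ?m u) $ a = 
      (W *\<^sub>v u) $ a + (\<Sum>b<p. W $$ (a, b) * (taylor_truncate x0 ?m u $ b - u $ b))"
    using W u' a taylor_truncate_carrier[OF u']
    by (simp add: mult_mat_vec_index del: index_mult_mat_vec) (simp add: algebra_simps sum_subtractf)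
  moreover have "[:- x0, 1:] ^ ?m dvd (\<Sum>b<p. W $$ (a, b) * (taylor_truncate x0 ?m u $ b - u $ b))"
    using u' by (intro dvd_sum dvd_mult dvd_diff_taylor_truncate) auto
  ultimately show ?thesis using root_order_dvd[OF assms] by simp
qed

text \<open>The column order of \<open>root_jets\<close>, kept as a list of index triples so that
  the column \<open>c\<close> can be addressed as its \<open>c\<close>-th element.\<close>

definition jet_index :: "nat \<Rightarrow> (nat \<Rightarrow> nat) \<Rightarrow> (nat \<Rightarrow> nat \<Rightarrow> nat) \<Rightarrow> (nat \<times> nat \<times> nat) list" where
  "jet_index q s \<kappa> = [(i, j, r). i \<leftarrow> [0..<q], j \<leftarrow> [0..<s i], r \<leftarrow> [0..<\<kappa> i j]]"

text \<open>One column of \<open>root_jets\<close> seen as a linear functional on a row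
  \<open>g\<close> of polynomials. Linearity carries polynomial identities over to the matrices
  built from jets.\<close>

definition jet :: "nat \<Rightarrow> (nat \<Rightarrow> complex) \<Rightarrow> (nat \<Rightarrow> nat \<Rightarrow> complex poly vec) \<Rightarrow> 
    nat \<times> nat \<times> nat \<Rightarrow> (nat \<Rightarrow> complex poly) \<Rightarrow> complex" where
  "jet p x v t g = (case t of (i, j, r) \<Rightarrow> poly ((pderiv ^^ r) (\<Sum>b<p. g b * v i j $ b)) (x i))"

lemma set_jet_index: "set (jet_index q s \<kappa>) = {(i, j, r). i < q \<and> j < s i \<and> r < \<kappa> i j}"
  by (force simp: jet_index_def)

text \<open>The carrier condition is restricted to the index range of the list, because outside it
  the choice of root polynomials is unconstrained.\<close>

lemma root_jets_eq:
  assumes F: "F \<in> carrier_mat p p" and v: "\<And>i j. i < q \<Longrightarrow> j < s i \<Longrightarrow> v i j \<in> carrier_vec p"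
  shows "root_jets p q x s \<kappa> v F = mat p (length (jet_index q s \<kappa>))
    (\<lambda>(a, c). jet p x v (jet_index q s \<kappa> ! c) (\<lambda>b. F $$ (a, b)))"
proof -
  let ?J = "jet_index q s \<kappa>"
  have eq: "root_jets p q x s \<kappa> v F
      = mat_of_cols p (map (\<lambda>(i, j, r). map_vec (\<lambda>f. poly ((pderiv ^^ r) f) (x i)) (F *\<^sub>v v i j)) ?J)"
    by (simp add: root_jets_def jet_index_def map_concat o_def)
  show ?thesis
  proof (rule eq_matI)
    fix a c assume "a < dim_row (mat p (length ?J) (\<lambda>(a, c). jet p x v (?J ! c) (\<lambda>b. F $$ (a, b))))"
      and "c < dim_col (mat p (length ?J) (\<lambda>(a, c). jet p x v (?J ! c) (\<lambda>b. F $$ (a, b))))"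
    then have ac: "a < p" "c < length ?J" by auto
    obtain i j r where t: "?J ! c = (i, j, r)" by (cases "?J ! c")
    then have "i < q" "j < s i" using nth_mem[OF ac(2)] by (auto simp: set_jet_index)
    then show "root_jets p q x s \<kappa> v F $$ (a, c) 
        = mat p (length ?J) (\<lambda>(a, c). jet p x v (?J ! c) (\<lambda>b. F $$ (a, b))) $$ (a, c)"
      using ac t F v unfolding eq
      by (simp add: mat_of_cols_def jet_def mult_mat_vec_index del: index_mult_mat_vec)
  qed (simp_all add: eq)
qed

lemma smult_sum_right: "Polynomial.smult c (\<Sum>i\<in>A. f i) = (\<Sum>i\<in>A. Polynomial.smult c (f i))"
  by (rule poly_eqI) (simp add: coeff_sum sum_distrib_left)

lemma jet_cong:
  "(\<And>b. b < p \<Longrightarrow> f b = g b) \<Longrightarrow> jet p x v t f = jet p x v t g"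
  by (simp add: jet_def split: prod.split)

lemma jet_add: "jet p x v t (\<lambda>b. f b + g b) = jet p x v t f + jet p x v t g"
  by (simp add: jet_def algebra_simps sum.distrib higher_pderiv_add split: prod.split)

lemma jet_smult: "jet p x v t (\<lambda>b. Polynomial.smult c (f b)) = c * jet p x v t f"
proof (cases t)
  case (fields i j r)
  have "(\<Sum>b<p. Polynomial.smult c (f b) * v i j $ b) = Polynomial.smult c (\<Sum>b<p. f b * v i j $ b)"
    by (simp add: smult_sum_right)
  then show ?thesis using fields by (simp add: jet_def higher_pderiv_smult)
qed

lemma jet_sum: "jet p x v t (\<lambda>b. \<Sum>k\<in>A. f k b) = (\<Sum>k\<in>A. jet p x v t (f k))"
proof (induction A rule: infinite_finite_induct)
  case (insert a A)
  then show ?case by (simp add: jet_add)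
qed (simp_all add: jet_def split: prod.split)

text \<open>\<open>(G W) v = G (W v)\<close> inherits from \<open>W v\<close> a zero of order at
  least \<open>m\<close>, so its derivatives of order below \<open>m\<close> vanish at
  \<open>x i\<close>.\<close>

lemma jet_mult_eq_0:
  assumes W: "W \<in> carrier_mat p p" and G: "G \<in> carrier_mat p p" and v: "v i j \<in> carrier_vec p"
    and dvd: "\<And>d. d < p \<Longrightarrow> [:- x i, 1:] ^ m dvd (W *\<^sub>v v i j) $ d" and r: "r < m" and a: "a < p"
  shows "jet p x v (i, j, r) (\<lambda>b. (G * W) $$ (a, b)) = 0"
proof -
  have "(\<Sum>b<p. (G * W) $$ (a, b) * v i j $ b) = (\<Sum>d<p. G $$ (a, d) * (W *\<^sub>v v i j) $ d)"
  proof -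
    have "(\<Sum>b<p. (G * W) $$ (a, b) * v i j $ b) = ((G * W) *\<^sub>v v i j) $ a"
      using W G v a by (intro mult_mat_vec_index[symmetric]) auto
    also have "(G * W) *\<^sub>v v i j = G *\<^sub>v (W *\<^sub>v v i j)"
      using W G v by (intro assoc_mult_mat_vec)
    also have "\<dots> $ a = (\<Sum>d<p. G $$ (a, d) * (W *\<^sub>v v i j) $ d)"
      using W G v a by (intro mult_mat_vec_index) auto
    finally show ?thesis .
  qed
  also have "[:- x i, 1:] ^ m dvd \<dots>" using dvd by (intro dvd_sum dvd_mult) auto
  finally show ?thesis using r by (simp add: jet_def poly_higher_pderiv_eq_0)
qed

section \<open>Connection formulas\<close>

lemma cpoly_mat_index:
  "a < dim_row P \<Longrightarrow> b < dim_col P \<Longrightarrow> cpoly_mat P $$ (a, b) = map_poly complex_of_real (P $$ (a, b))"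
  by (simp add: cpoly_mat_def)

lemma cpoly_mat_carrier [simp]: 
  "P \<in> carrier_mat n m \<Longrightarrow> cpoly_mat P \<in> carrier_mat n m"
  "dim_row (cpoly_mat P) = dim_row P" "dim_col (cpoly_mat P) = dim_col P"
  by (simp_all add: cpoly_mat_def)

lemma mat_at_carrier [simp]: 
  "P \<in> carrier_mat n m \<Longrightarrow> mat_at P z \<in> carrier_mat n m"
  "dim_row (mat_at P z) = dim_row P" "dim_col (mat_at P z) = dim_col P"
  by (simp_all add: mat_at_def)

lemma cmat_carrier [simp]: 
  "A \<in> carrier_mat n m \<Longrightarrow> cmat A \<in> carrier_mat n m"
  "dim_row (cmat A) = dim_row A" "dim_col (cmat A) = dim_col A"
  by (simp_all add: cmat_def)

lemma cmat_index: "a < dim_row A \<Longrightarrow> b < dim_col A \<Longrightarrow> cmat A $$ (a, b) = complex_of_real (A $$ (a, b))"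
  by (simp add: cmat_def)

lemma mat_at_index: "a < dim_row P \<Longrightarrow> b < dim_col P \<Longrightarrow> mat_at P z $$ (a, b) = poly (P $$ (a, b)) z"
  by (simp add: mat_at_def)

lemma cpoly_mat_mult:
  assumes "P \<in> carrier_mat n m" "Q \<in> carrier_mat m k"
  shows "cpoly_mat (P * Q) = cpoly_mat P * cpoly_mat Q"
proof -
  have "semiring_hom (map_poly complex_of_real)"
    by unfold_locales (auto simp: poly_eq_iff coeff_map_poly coeff_mult)
  then show ?thesis unfolding cpoly_mat_def by (rule semiring_hom.mat_hom_mult) (use assms in auto)
qed

lemma map_poly_of_real_sum_smult:
  "map_poly complex_of_real (\<Sum>k\<in>A. \<Sum>c\<in>B. Polynomial.smult (r k c) (f k c))
    = (\<Sum>k\<in>A. \<Sum>c\<in>B. Polynomial.smult (complex_of_real (r k c)) (map_poly complex_of_real (f k c)))"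
  by (rule poly_eqI) (simp add: coeff_map_poly coeff_sum)

lemma sum_mult_sum_assoc:
  fixes f :: "'a \<Rightarrow> 'c :: comm_semiring_0"
  shows "(\<Sum>d\<in>B. (\<Sum>e\<in>A. f e * g e d) * h d) = (\<Sum>e\<in>A. f e * (\<Sum>d\<in>B. g e d * h d))"
  by (simp add: sum_distrib_left sum_distrib_right mult.assoc) (rule sum.swap)

text \<open>\<open>w k j a b\<close> is the entry \<open>(a, b)\<close> of the resolvent block
  \<open>\<omega> k j\<close>, made complex. The last clause transposes \<open>S2 = U T2\<close> and
  replaces \<open>U\<close> by \<open>\<omega>\<close>, so that one set of coefficients governs both
  families.\<close>

lemma christoffel_connection:
  assumes W: "monic_mpoly p N W"
    and G: "block_gauss p M S1 H S2"
    and Gh: "block_gauss p (bprod p (mpoly_at_shift p W) M) T1 K T2"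
  obtains w :: "nat \<Rightarrow> nat \<Rightarrow> nat \<Rightarrow> nat \<Rightarrow> complex" where
    "\<And>k j a b. a < p \<Longrightarrow> b < p \<Longrightarrow> j < k \<or> k + N < j \<Longrightarrow> w k j a b = 0"
    "\<And>k a b. a < p \<Longrightarrow> b < p \<Longrightarrow> w k (k + N) a b = (if a = b then 1 else 0)"
    "\<And>k a b. a < p \<Longrightarrow> b < p \<Longrightarrow> cmat (K k) $$ (a, b) = (\<Sum>c<p. w k k a c * cmat (H k) $$ (c, b))"
    "\<And>k a b. a < p \<Longrightarrow> b < p \<Longrightarrow> cpoly_mat (gauss_poly p T1 k * W) $$ (a, b)
       = (\<Sum>j\<le>k + N. \<Sum>c<p. Polynomial.smult (w k j a c) (cpoly_mat (gauss_poly p S1 j) $$ (c, b)))"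
    "\<And>y j a b. a < p \<Longrightarrow> b < p \<Longrightarrow>
       (transpose_mat (mat_at (cpoly_mat (gauss_poly p S2 j)) y) * cmat (minv (H j))) $$ (a, b)
       = (\<Sum>k\<le>j. \<Sum>d<p. (transpose_mat (mat_at (cpoly_mat (gauss_poly p T2 k)) y) * cmat (minv (K k))) $$ (a, d)
            * w k j d b)"
proof -
  obtain \<omega> U where band: "unit_band p N \<omega>" and U: "lower_unitriangular p U"
    and \<omega>S1: "bprod p \<omega> S1 = bprod p T1 (mpoly_at_shift p W)"
    and UT2: "bprod p U T2 = S2"
    and \<omega>H: "\<And>k j. \<omega> k j * H j = K k * transpose_mat (U j k)"
    using block_gauss_resolvent[OF W G Gh] by blast
  have W': "W \<in> carrier_mat p p" using W by (simp add: monic_mpoly_def)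
  have low: "lower_unitriangular p S1" "lower_unitriangular p S2" 
    "lower_unitriangular p T1" "lower_unitriangular p T2"
    and H: "H k \<in> carrier_mat p p" and K: "K k \<in> carrier_mat p p" 
    and "invertible_mat (H k)" "invertible_mat (K k)" for k
    using G Gh by (auto simp: block_gauss_def)
  then have detH: "det (H k) \<noteq> 0" and detK: "det (K k) \<noteq> 0" for k
    by (metis det_nonzero_of_invertible)+
  note iH = minv_inverse[OF H detH] and iK = minv_inverse[OF K detK]
  have \<omega>c: "\<omega> k j \<in> carrier_mat p p" for k j using unit_bandD(1)[OF band] by simp
  have Uc: "transpose_mat (U j k) \<in> carrier_mat p p" for k j using U by simp
  have \<omega>_eq: "\<omega> k j = K k * (transpose_mat (U j k) * minv (H j))" for k j
  proof -
    have "\<omega> k j = \<omega> k j * (H j * minv (H j))" by (simp add: iH right_mult_one_mat[OF \<omega>c])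
    also have "\<dots> = \<omega> k j * H j * minv (H j)" by (rule assoc_mult_mat[symmetric, OF \<omega>c H iH(1)])
    also have "\<dots> = K k * (transpose_mat (U j k) * minv (H j))"
      unfolding \<omega>H by (rule assoc_mult_mat[OF K Uc iH(1)])
    finally show ?thesis .
  qed
  \<comment> \<open>This trades the connection matrix \<open>U\<close> of the second family for the
    resolvent.\<close>
  have key: "minv (K k) * \<omega> k j = transpose_mat (U j k) * minv (H j)" for k j
  proof -
    have c: "transpose_mat (U j k) * minv (H j) \<in> carrier_mat p p" using Uc iH(1) by (rule mult_carrier_mat)
    have "minv (K k) * \<omega> k j = minv (K k) * K k * (transpose_mat (U j k) * minv (H j))"
      unfolding \<omega>_eq by (rule assoc_mult_mat[symmetric, OF iK(1) K c])
    then show ?thesis using c by (simp add: iK left_mult_one_mat[OF c])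
  qed
  \<comment> \<open>Vanishing below the diagonal comes from the second expression of
    \<open>\<omega>\<close>, since \<open>U j k\<close> is zero for \<open>j < k\<close>.\<close>
  have tri: "\<omega> k j = 0\<^sub>m p p" if "j < k" for k j
  proof -
    have "transpose_mat (U j k) * minv (H j) = 0\<^sub>m p p" 
      using U that left_mult_zero_mat[OF iH(1)] by simp
    then show ?thesis unfolding \<omega>_eq using right_mult_zero_mat[OF K] by simp
  qed
  have diag: "\<omega> k k * H k = K k" for k unfolding \<omega>H using U by (simp add: right_mult_one_mat[OF K])
  define w where "w = (\<lambda>k j a b. complex_of_real (\<omega> k j $$ (a, b)))"
  show thesis
  proof (rule that[of w])
    fix k j a b assume ab: "a < p" "b < p" and "j < k \<or> k + N < j"
    then have "\<omega> k j = 0\<^sub>m p p" using tri unit_bandD(3)[OF band] by blast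
    then show "w k j a b = 0" using ab by (simp add: w_def)
  next
    fix k a b assume ab: "a < p" "b < p"
    then show "w k (k + N) a b = (if a = b then 1 else 0)" by (simp add: w_def unit_bandD(2)[OF band])
    have "K k $$ (a, b) = (\<Sum>c<p. \<omega> k k $$ (a, c) * H k $$ (c, b))"
      unfolding diag[of k, symmetric] using ab by (intro index_mult_square \<omega>c H)
    then show "cmat (K k) $$ (a, b) = (\<Sum>c<p. w k k a c * cmat (H k) $$ (c, b))"
      using ab carrier_matD[OF H[of k]] carrier_matD[OF K[of k]] by (simp add: w_def cmat_index)
    have "bprod p \<omega> S1 k i $$ (a, b) = coeff ((gauss_poly p T1 k * W) $$ (a, b)) i" for i
      using gauss_poly_mult_mpoly[OF W' low(3) ab] \<omega>S1 by simp
    from gauss_poly_bprod[OF band low(1) ab this]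
    show "cpoly_mat (gauss_poly p T1 k * W) $$ (a, b)
       = (\<Sum>j\<le>k + N. \<Sum>c<p. Polynomial.smult (w k j a c) (cpoly_mat (gauss_poly p S1 j) $$ (c, b)))"
      using ab carrier_matD[OF W'] by (simp add: cpoly_mat_index map_poly_of_real_sum_smult w_def)
  next
    fix y j a b assume ab: "a < p" "b < p"
    let ?ev = "\<lambda>S k c a. poly (map_poly complex_of_real (gauss_poly p S k $$ (c, a))) y"
    let ?h = "\<lambda>c b. complex_of_real (minv (H j) $$ (c, b))"
    let ?u = "\<lambda>k c d. complex_of_real (U j k $$ (c, d))"
    let ?k = "\<lambda>k e d. complex_of_real (minv (K k) $$ (e, d))"
    have idx: "(transpose_mat (mat_at (cpoly_mat (gauss_poly p S k)) y) * cmat A) $$ (a, d)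
        = (\<Sum>c<p. ?ev S k c a * complex_of_real (A $$ (c, d)))"
      if "A \<in> carrier_mat p p" "d < p" for S k A d
      using that ab by (subst index_mult_square[where p=p]) 
        (auto simp: cpoly_mat_index mat_at_index cmat_index)
    have ev: "?ev S2 j c a = (\<Sum>k\<le>j. \<Sum>d<p. ?ev T2 k d a * ?u k c d)" if c: "c < p" for c
    proof -
      have "bprod p U T2 j i $$ (c, a) = coeff (gauss_poly p S2 j $$ (c, a)) i" for i
        using UT2 coeff_gauss_poly[OF low(2) c ab(1)] by simp
      from gauss_poly_bprod[OF U[unfolded lower_unitriangular_iff_unit_band] low(4) c ab(1) this]
      show ?thesis by (simp add: map_poly_of_real_sum_smult poly_sum mult.commute)
    qed
    have inner: "(\<Sum>c<p. ?u k c e * ?h c b) = (\<Sum>d<p. ?k k e d * w k j d b)" if e: "e < p" for k e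
    proof -
      have "(\<Sum>c<p. U j k $$ (c, e) * minv (H j) $$ (c, b)) = (transpose_mat (U j k) * minv (H j)) $$ (e, b)"
        using e ab is_bmatD(2,3)[OF is_bmat_lower[OF U]]
        by (subst index_mult_square[OF Uc iH(1)]) simp_all
      also have "\<dots> = (\<Sum>d<p. minv (K k) $$ (e, d) * \<omega> k j $$ (d, b))"
        unfolding key[symmetric] using e ab by (intro index_mult_square iK(1) \<omega>c)
      finally have "complex_of_real (\<Sum>c<p. U j k $$ (c, e) * minv (H j) $$ (c, b)) 
        = complex_of_real (\<Sum>d<p. minv (K k) $$ (e, d) * \<omega> k j $$ (d, b))" by simp
      then show ?thesis by (simp add: w_def)
    qed
    have "(transpose_mat (mat_at (cpoly_mat (gauss_poly p S2 j)) y) * cmat (minv (H j))) $$ (a, b)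
        = (\<Sum>c<p. (\<Sum>k\<le>j. \<Sum>d<p. ?ev T2 k d a * ?u k c d) * ?h c b)"
      using ab by (simp add: idx[OF iH(1)] ev)
    also have "\<dots> = (\<Sum>k\<le>j. \<Sum>c<p. (\<Sum>d<p. ?ev T2 k d a * ?u k c d) * ?h c b)"
      by (subst sum.swap) (simp only: sum_distrib_right)
    also have "\<dots> = (\<Sum>k\<le>j. \<Sum>d<p. ?ev T2 k d a * (\<Sum>c<p. ?u k c d * ?h c b))"
      by (simp only: sum_mult_sum_assoc)
    also have "\<dots> = (\<Sum>k\<le>j. \<Sum>e<p. ?ev T2 k e a * (\<Sum>d<p. ?k k e d * w k j d b))"
      by (simp add: inner)
    also have "\<dots> = (\<Sum>k\<le>j. \<Sum>d<p. (\<Sum>e<p. ?ev T2 k e a * ?k k e d) * w k j d b)"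
      by (simp only: sum_mult_sum_assoc)
    also have "\<dots> = (\<Sum>k\<le>j. \<Sum>d<p. (transpose_mat (mat_at (cpoly_mat (gauss_poly p T2 k)) y) * cmat (minv (K k))) $$ (a, d)
            * w k j d b)"
      by (intro sum.cong refl) (simp add: idx[OF iK(1)])
    finally show "(transpose_mat (mat_at (cpoly_mat (gauss_poly p S2 j)) y) * cmat (minv (H j))) $$ (a, b)
       = (\<Sum>k\<le>j. \<Sum>d<p. (transpose_mat (mat_at (cpoly_mat (gauss_poly p T2 k)) y) * cmat (minv (K k))) $$ (a, d)
            * w k j d b)" .
  qed
qed


lemma block_gaussD:
  assumes "block_gauss p M S1 H S2"
  shows "H k \<in> carrier_mat p p" "minv (H k) \<in> carrier_mat p p"
proof -
  show H: "H k \<in> carrier_mat p p" using assms by (simp add: block_gauss_def)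
  have "invertible_mat (H k)" using assms by (simp add: block_gauss_def)
  then show "minv (H k) \<in> carrier_mat p p"
    using minv_inverse(1) det_nonzero_of_invertible H by blast
qed

theorem mainTheorem4:
  fixes p N q :: nat
    and M S1 S2 Shat1 Shat2 :: bmat
    and H Hhat :: "nat \<Rightarrow> real mat"
    and W :: "real poly mat"
    and t1 t2 :: "nat \<Rightarrow> real"
    and P1 P2 Phat1 Phat2 :: "nat \<Rightarrow> real poly mat"
    and x :: "nat \<Rightarrow> complex"
    and s :: "nat \<Rightarrow> nat"
    and \<kappa> :: "nat \<Rightarrow> nat \<Rightarrow> nat"
    and u v :: "nat \<Rightarrow> nat \<Rightarrow> complex poly vec"
    and \<pi> :: "nat \<Rightarrow> complex mat"
    and \<Pi>\<^sub>N :: "nat \<Rightarrow> complex mat"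
    and \<gamma> :: "nat \<Rightarrow> complex \<Rightarrow> complex mat"
  assumes "1 \<le> p" and "1 \<le> N"
    and "is_bmat p M"
    and "monic_mpoly p N W"
    and "toda_defined p t1 t2 M"
    and "toda_defined p t1 t2 (bprod p (mpoly_at_shift p W) M)"
    and "block_gauss p (toda_evolve p t1 t2 M) S1 H S2"
    and "block_gauss p (toda_evolve p t1 t2 (bprod p (mpoly_at_shift p W) M)) Shat1 Hhat Shat2"
    and "P1 = gauss_poly p S1" and "P2 = gauss_poly p S2"
    and "Phat1 = gauss_poly p Shat1" and "Phat2 = gauss_poly p Shat2"
    and "inj_on x {..<q}"
    and "x ` {..<q} = {z. poly (det (cpoly_mat W)) z = 0}"
    and "\<And>i. s i = kernel_dim (mat_at (cpoly_mat W) (x i))"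
    and "\<And>i. i < q \<Longrightarrow> maximal_root_polys p (cpoly_mat W) (x i) (s i) (u i)"
    and "\<And>i j. \<kappa> i j = root_order (cpoly_mat W) (x i) (u i j)"
    and "\<And>i j. v i j = taylor_truncate (x i) (\<kappa> i j) (u i j)"
    and "\<And>k. \<pi> k = root_jets p q x s \<kappa> v (cpoly_mat (P1 k))"
    and "\<And>k. \<Pi>\<^sub>N k = block_column p N (\<lambda>l. \<pi> (k + l))"
    and "\<And>n y. \<gamma> n y = root_jets p q x s \<kappa> v (CD_kernel p P1 P2 H n y)"
  shows "\<forall>k.
    (det (\<Pi>\<^sub>N k) \<noteq> 0 \<longrightarrow>
       (\<forall>z. mat_at (cpoly_mat (Phat1 k * W)) z =
          last_quasidet
            (\<Pi>\<^sub>N k)   (block_column p N (\<lambda>l. mat_at (cpoly_mat (P1 (k + l))) z))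
            (\<pi> (k + N)) (mat_at (cpoly_mat (P1 (k + N))) z)) \<and>
       cmat (Hhat k) =
          last_quasidet
            (\<Pi>\<^sub>N k)   (block_column p N (\<lambda>l. if l = 0 then cmat (H k) else 0\<^sub>m p p))
            (\<pi> (k + N)) (0\<^sub>m p p)) \<and>
    (det (\<Pi>\<^sub>N (Suc k)) \<noteq> 0 \<longrightarrow>
       (\<forall>z. transpose_mat (mat_at (cpoly_mat (Phat2 k)) z) * cmat (minv (Hhat k)) =
          last_quasidet
            (\<Pi>\<^sub>N (Suc k)) (block_column p N (\<lambda>l. if l = N - 1 then 1\<^sub>m p else 0\<^sub>m p p))
            (\<gamma> k z)     (0\<^sub>m p p)))"
proof (intro allI conjI impI)

  \<comment> \<open>Resolvent coefficients and the vanishing of jets on multiples of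
    \<open>W\<close>\<close>
  let ?J = "jet_index q s \<kappa>" and ?W = "cpoly_mat W"
  note p = assms(1) and N = assms(2) and W = assms(4) and G = assms(7)
  note P_eq = assms(9-12)
  have W': "W \<in> carrier_mat p p" using W by (simp add: monic_mpoly_def)
  then have Wc: "?W \<in> carrier_mat p p" by simp
  have Gh: "block_gauss p (bprod p (mpoly_at_shift p W) (toda_evolve p t1 t2 M)) Shat1 Hhat Shat2"
    using assms(8) unfolding toda_evolve_mpoly_at_shift[OF W assms(3,5)] .
  obtain w :: "nat \<Rightarrow> nat \<Rightarrow> nat \<Rightarrow> nat \<Rightarrow> complex" where
    w0: "\<And>k j a b. a < p \<Longrightarrow> b < p \<Longrightarrow> j < k \<or> k + N < j \<Longrightarrow> w k j a b = 0" and
    w1: "\<And>k a b. a < p \<Longrightarrow> b < p \<Longrightarrow> w k (k + N) a b = (if a = b then 1 else 0)" and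
    wH: "\<And>k a b. a < p \<Longrightarrow> b < p \<Longrightarrow> cmat (Hhat k) $$ (a, b) = (\<Sum>c<p. w k k a c * cmat (H k) $$ (c, b))" and
    wP: "\<And>k a b. a < p \<Longrightarrow> b < p \<Longrightarrow> cpoly_mat (Phat1 k * W) $$ (a, b)
       = (\<Sum>j\<le>k + N. \<Sum>c<p. Polynomial.smult (w k j a c) (cpoly_mat (P1 j) $$ (c, b)))" and
    wK: "\<And>y j a b. a < p \<Longrightarrow> b < p \<Longrightarrow>
       (transpose_mat (mat_at (cpoly_mat (P2 j)) y) * cmat (minv (H j))) $$ (a, b)
       = (\<Sum>k\<le>j. \<Sum>d<p. (transpose_mat (mat_at (cpoly_mat (Phat2 k)) y) * cmat (minv (Hhat k))) $$ (a, d)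
            * w k j d b)"
    using christoffel_connection[OF W G Gh] unfolding P_eq by blast
  have H: "\<And>k. H k \<in> carrier_mat p p" and Hh: "\<And>k. Hhat k \<in> carrier_mat p p"
    and iHh: "\<And>k. minv (Hhat k) \<in> carrier_mat p p" and iH: "\<And>k. minv (H k) \<in> carrier_mat p p"
    using block_gaussD[OF G] block_gaussD[OF Gh] by blast+
  have Pc: "P1 k \<in> carrier_mat p p" "P2 k \<in> carrier_mat p p" 
    "Phat1 k \<in> carrier_mat p p" "Phat2 k \<in> carrier_mat p p" for k
    unfolding P_eq by simp_all
  have cPc: "cpoly_mat (P1 k) \<in> carrier_mat p p" "mat_at (cpoly_mat (P1 k)) z \<in> carrier_mat p p" for k z
    using Pc by simp_all

  \<comment> \<open>The zero set of a zero determinant would be infinite.\<close>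
  have det_W: "det ?W \<noteq> 0"
  proof
    assume "det ?W = 0"
    then have "x ` {..<q} = UNIV" unfolding assms(14) by simp
    moreover have "finite (x ` {..<q})" by simp
    ultimately have "finite (UNIV :: complex set)" by (simp only:)
    then show False by (simp add: infinite_UNIV_char_0)
  qed
  have root: "root_poly p ?W (x i) (u i j)" if "i < q" "j < s i" for i j
    using assms(16)[OF that(1)] that(2) by (auto simp: maximal_root_polys_def)
  have vc: "v i j \<in> carrier_vec p" if "i < q" "j < s i" for i j
    unfolding assms(18) using root[OF that] by (auto simp: root_poly_def intro: taylor_truncate_carrier)
  \<comment> \<open>\<open>\<kappa> i j\<close> is both the order of \<open>u i j\<close> and the
    truncation degree, so \<open>W v\<close> keeps its full zero and every jet with
    \<open>r < \<kappa> i j\<close> annihilates \<open>F W\<close>.\<close>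
  have jet0: "jet p x v (?J ! c) (\<lambda>b. cpoly_mat (F * W) $$ (a, b)) = 0"
    if "F \<in> carrier_mat p p" "a < p" "c < length ?J" for F a c
  proof -
    obtain i j r where t: "?J ! c = (i, j, r)" by (cases "?J ! c")
    then have ijr: "i < q" "j < s i" "r < \<kappa> i j" using nth_mem[OF that(3)] by (auto simp: set_jet_index)
    have "[:- x i, 1:] ^ \<kappa> i j dvd (?W *\<^sub>v v i j) $ d" if "d < p" for d
      unfolding assms(17,18) by (rule root_order_dvd_taylor_truncate[OF Wc det_W root[OF ijr(1,2)] that])
    then show ?thesis unfolding t cpoly_mat_mult[OF that(1) W']
      using Wc that vc[OF ijr(1,2)] ijr(3) by (intro jet_mult_eq_0[of _ p]) simp_all
  qed
  have \<pi>_eq: "\<pi> k = mat p (length ?J) (\<lambda>(a, c). jet p x v (?J ! c) (\<lambda>b. cpoly_mat (P1 k) $$ (a, b)))" for k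
    unfolding assms(19) by (rule root_jets_eq[OF cPc(1) vc])
  have \<pi>c: "\<pi> k \<in> carrier_mat p (length ?J)" for k unfolding \<pi>_eq by simp
  have \<pi>_idx: "\<pi> k $$ (a, c) = jet p x v (?J ! c) (\<lambda>b. cpoly_mat (P1 k) $$ (a, b))" 
    if "a < p" "c < length ?J" for k a c
    unfolding \<pi>_eq using that by simp

  fix k
  {

    \<comment> \<open>The first family and the norms\<close>
    assume det: "det (\<Pi>\<^sub>N k) \<noteq> 0"
    \<comment> \<open>The band restricts the sum to \<open>k \<le> j \<le> k + N\<close>, and the
      identity block on the last superdiagonal splits off the top polynomial.\<close>
    have wP': "cpoly_mat (Phat1 k * W) $$ (a, b) = cpoly_mat (P1 (k + N)) $$ (a, b)
        + (\<Sum>l<N. \<Sum>e<p. Polynomial.smult (w k (k + l) a e) (cpoly_mat (P1 (k + l)) $$ (e, b)))"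
      if ab: "a < p" "b < p" for a b
    proof -
      let ?f = "\<lambda>j. \<Sum>e<p. Polynomial.smult (w k j a e) (cpoly_mat (P1 j) $$ (e, b))"
      have "cpoly_mat (Phat1 k * W) $$ (a, b) = (\<Sum>j\<in>{k..k + N}. ?f j)"
        unfolding wP[OF ab] using ab by (intro sum.mono_neutral_right) (auto simp: w0)
      also have "\<dots> = (\<Sum>l<Suc N. ?f (k + l))"
        by (rule sum.reindex_bij_witness[where i="\<lambda>l. k + l" and j="\<lambda>j. j - k"]) auto
      also have "?f (k + N) = (\<Sum>e<p. if e = a then cpoly_mat (P1 (k + N)) $$ (a, b) else 0)"
        using ab by (intro sum.cong) (auto simp: w1)
      then have "(\<Sum>l<Suc N. ?f (k + l)) = cpoly_mat (P1 (k + N)) $$ (a, b) + (\<Sum>l<N. ?f (k + l))"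
        using ab by simp
      finally show ?thesis .
    qed
    \<comment> \<open>Applying the jets to the previous expansion gives the linear system for the
      blocks of the \<open>k\<close>-th row of the resolvent. It serves both formulas below, which
      differ only in the last column of the quasideterminant.\<close>
    have X: "\<pi> (k + N) $$ (a, c) + (\<Sum>l<N. \<Sum>e<p. w k (k + l) a e * \<pi> (k + l) $$ (e, c)) = 0"
      if ac: "a < p" "c < length ?J" for a c
    proof -
      have "0 = jet p x v (?J ! c) (\<lambda>b. cpoly_mat (Phat1 k * W) $$ (a, b))" 
        using jet0[OF Pc(3) ac] by simp
      also have "\<dots> = jet p x v (?J ! c) (\<lambda>b. cpoly_mat (P1 (k + N)) $$ (a, b)
        + (\<Sum>l<N. \<Sum>e<p. Polynomial.smult (w k (k + l) a e) (cpoly_mat (P1 (k + l)) $$ (e, b))))"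
        by (rule jet_cong) (rule wP'[OF ac(1)])
      also have "\<dots> = \<pi> (k + N) $$ (a, c) + (\<Sum>l<N. \<Sum>e<p. w k (k + l) a e * \<pi> (k + l) $$ (e, c))"
        using ac by (simp add: jet_add jet_sum jet_smult \<pi>_idx)
      finally show ?thesis by simp
    qed
    note quasidet = last_quasidet_block_column[where p=p and n=N and R="\<lambda>l. \<pi> (k + l)" 
        and C="\<pi> (k + N)" and m="length ?J" and X="\<lambda>l. w k (k + l)", folded assms(20)]
    show "mat_at (cpoly_mat (Phat1 k * W)) z = last_quasidet
            (\<Pi>\<^sub>N k)   (block_column p N (\<lambda>l. mat_at (cpoly_mat (P1 (k + l))) z))
            (\<pi> (k + N)) (mat_at (cpoly_mat (P1 (k + N))) z)" for z
    proof (rule quasidet)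
      fix a b assume ab: "a < p" "b < p"
      have "mat_at (cpoly_mat (Phat1 k * W)) z $$ (a, b) = poly (cpoly_mat (Phat1 k * W) $$ (a, b)) z"
        using ab carrier_matD[OF Pc(3)[of k]] carrier_matD[OF W'] by (simp add: mat_at_index)
      then show "mat_at (cpoly_mat (Phat1 k * W)) z $$ (a, b) = mat_at (cpoly_mat (P1 (k + N))) z $$ (a, b)
         + (\<Sum>l<N. \<Sum>e<p. w k (k + l) a e * mat_at (cpoly_mat (P1 (k + l))) z $$ (e, b))"
        using ab carrier_matD[OF Pc(1)] unfolding wP'[OF ab] by (simp add: mat_at_index poly_sum)
    next
      show "mat_at (cpoly_mat (Phat1 k * W)) z \<in> carrier_mat p p"
        using mult_carrier_mat[OF Pc(3) W'] by simp
    qed (use p N det \<pi>c cPc X in auto)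
    show "cmat (Hhat k) = last_quasidet
            (\<Pi>\<^sub>N k)   (block_column p N (\<lambda>l. if l = 0 then cmat (H k) else 0\<^sub>m p p))
            (\<pi> (k + N)) (0\<^sub>m p p)"
    proof (rule quasidet)
      fix a b assume ab: "a < p" "b < p"
      let ?B = "\<lambda>l. if l = 0 then cmat (H k) else 0\<^sub>m p p"
      \<comment> \<open>The last column selects the diagonal block of the resolvent, whose product
        with \<open>H k\<close> is the new norm.\<close>
      have "(\<Sum>l<N. \<Sum>e<p. w k (k + l) a e * ?B l $$ (e, b)) = (\<Sum>l\<in>{0}. \<Sum>e<p. w k (k + l) a e * ?B l $$ (e, b))"
        using N ab by (intro sum.mono_neutral_right) auto
      then show "cmat (Hhat k) $$ (a, b) = 0\<^sub>m p p $$ (a, b) + (\<Sum>l<N. \<Sum>e<p. w k (k + l) a e * ?B l $$ (e, b))"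
        using wH[OF ab] ab by simp
    qed (use p N det \<pi>c H Hh X in auto)
  next

    \<comment> \<open>The second family and the Christoffel--Darboux kernel\<close>
    assume det: "det (\<Pi>\<^sub>N (Suc k)) \<noteq> 0"
    fix z
    \<comment> \<open>\<open>Q\<close> and \<open>R\<close> are the new and old second families at
      \<open>z\<close>, normalised by the inverse norms, so that \<open>wK\<close> reads
      \<open>R = Q \<omega>\<close>. \<open>Z l\<close> is column \<open>Suc k + l\<close> of this
      product with the sum cut at \<open>j \<le> k\<close>.\<close>
    define Q where "Q j = transpose_mat (mat_at (cpoly_mat (Phat2 j)) z) * cmat (minv (Hhat j))" for j
    define R where "R j = transpose_mat (mat_at (cpoly_mat (P2 j)) z) * cmat (minv (H j))" for j
    define Z where "Z l a c = (\<Sum>j\<le>k. \<Sum>d<p. Q j $$ (a, d) * w j (Suc k + l) d c)" for l a c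
    have Qc: "Q j \<in> carrier_mat p p" and Rc: "R j \<in> carrier_mat p p" for j 
      unfolding Q_def R_def using Pc iH iHh 
      by (auto intro!: mult_carrier_mat[of _ p p] simp: transpose_carrier_mat)
    have Kc: "CD_kernel p P1 P2 H k z \<in> carrier_mat p p" by (simp add: CD_kernel_def)
    have K_idx: "CD_kernel p P1 P2 H k z $$ (a, b) 
        = (\<Sum>j\<le>k. \<Sum>c<p. Polynomial.smult (R j $$ (a, c)) (cpoly_mat (P1 j) $$ (c, b)))" 
      if ab: "a < p" "b < p" for a b
    proof -
      have "(map_mat (\<lambda>c. [:c:]) (R j) * cpoly_mat (P1 j)) $$ (a, b) 
          = (\<Sum>c<p. Polynomial.smult (R j $$ (a, c)) (cpoly_mat (P1 j) $$ (c, b)))" for j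
        using ab Rc[of j] by (subst index_mult_square[OF _ cPc(1)]) auto
      then show ?thesis using ab by (simp add: CD_kernel_def R_def)
    qed
    \<comment> \<open>Truncating the sum \<open>\<Sum>\<^sub>j Q\<^sub>j \<omega>\<^sub>j\<^sub>m = R\<^sub>m\<close> at \<open>j \<le> k\<close> only affects the columns \<open>m > k\<close>.\<close>
    have CD: "(\<Sum>j\<le>k. \<Sum>d<p. Polynomial.smult (Q j $$ (a, d)) (cpoly_mat (Phat1 j * W) $$ (d, b)))
        = CD_kernel p P1 P2 H k z $$ (a, b)
          + (\<Sum>l<N. \<Sum>c<p. Polynomial.smult (Z l a c) (cpoly_mat (P1 (Suc k + l)) $$ (c, b)))"
      if ab: "a < p" "b < p" for a b
    proof -
      let ?P = "\<lambda>m c. cpoly_mat (P1 m) $$ (c, b)"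
      let ?S = "\<lambda>m c. \<Sum>j\<le>k. \<Sum>d<p. Q j $$ (a, d) * w j m d c"
      \<comment> \<open>All rows \<open>j \<le> k\<close> get the common upper limit
        \<open>k + N\<close>; the added coefficients lie outside the band.\<close>
      have wP'': "cpoly_mat (Phat1 j * W) $$ (d, b) 
          = (\<Sum>m<Suc k + N. \<Sum>c<p. Polynomial.smult (w j m d c) (?P m c))" if "j \<le> k" "d < p" for j d
        unfolding wP[OF that(2) ab(2)] using that by (intro sum.mono_neutral_left) (auto simp: w0)
      have "(\<Sum>j\<le>k. \<Sum>d<p. Polynomial.smult (Q j $$ (a, d)) (cpoly_mat (Phat1 j * W) $$ (d, b)))
          = (\<Sum>j\<le>k. \<Sum>d<p. \<Sum>m<Suc k + N. \<Sum>c<p. Polynomial.smult (Q j $$ (a, d) * w j m d c) (?P m c))"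
        by (intro sum.cong refl) (simp add: wP'' smult_sum_right smult_add_right)
      also have "\<dots> = (\<Sum>j\<le>k. \<Sum>m<Suc k + N. \<Sum>d<p. \<Sum>c<p. Polynomial.smult (Q j $$ (a, d) * w j m d c) (?P m c))"
        by (intro sum.cong refl sum.swap)
      also have "\<dots> = (\<Sum>m<Suc k + N. \<Sum>j\<le>k. \<Sum>d<p. \<Sum>c<p. Polynomial.smult (Q j $$ (a, d) * w j m d c) (?P m c))"
        by (rule sum.swap)
      also have "\<dots> = (\<Sum>m<Suc k + N. \<Sum>j\<le>k. \<Sum>c<p. \<Sum>d<p. Polynomial.smult (Q j $$ (a, d) * w j m d c) (?P m c))"
        by (intro sum.cong refl sum.swap)
      also have "\<dots> = (\<Sum>m<Suc k + N. \<Sum>c<p. \<Sum>j\<le>k. \<Sum>d<p. Polynomial.smult (Q j $$ (a, d) * w j m d c) (?P m c))"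
        by (intro sum.cong refl sum.swap)
      also have "\<dots> = (\<Sum>m<Suc k + N. \<Sum>c<p. Polynomial.smult (?S m c) (?P m c))"
        by (simp only: Polynomial.smult_sum)
      also have "\<dots> = (\<Sum>m<Suc k. \<Sum>c<p. Polynomial.smult (?S m c) (?P m c))
          + (\<Sum>l<N. \<Sum>c<p. Polynomial.smult (?S (Suc k + l) c) (?P (Suc k + l) c))"
        by (rule sum_lessThan_add)
      also have "(\<Sum>m<Suc k. \<Sum>c<p. Polynomial.smult (?S m c) (?P m c)) = CD_kernel p P1 P2 H k z $$ (a, b)"
        unfolding K_idx[OF ab] lessThan_Suc_atMost
      proof (intro sum.cong refl arg_cong2[where f=Polynomial.smult])
        fix m c assume "m \<in> {..k}" "c \<in> {..<p}"
        then have mc: "m \<le> k" "c < p" by auto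
        have "?S m c = (\<Sum>j\<le>m. \<Sum>d<p. Q j $$ (a, d) * w j m d c)"
          using mc by (intro sum.mono_neutral_right) (auto simp: w0)
        also have "\<dots> = R m $$ (a, c)" unfolding Q_def R_def using wK[OF ab(1) mc(2)] by simp
        finally show "?S m c = R m $$ (a, c)" .
      qed
      finally show ?thesis unfolding Z_def .
    qed
    have \<gamma>_eq: "\<gamma> k z = mat p (length ?J) 
        (\<lambda>(a, c). jet p x v (?J ! c) (\<lambda>b. CD_kernel p P1 P2 H k z $$ (a, b)))"
      unfolding assms(21) by (rule root_jets_eq[OF Kc vc])
    \<comment> \<open>The left side of \<open>CD\<close> combines rows of the products of
      \<open>Phat1 j\<close> with \<open>W\<close>, so its jets vanish; the right side then becomes
      the linear system with unknowns \<open>Z\<close>.\<close>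
    have X: "\<gamma> k z $$ (a, c) + (\<Sum>l<N. \<Sum>e<p. Z l a e * \<pi> (Suc k + l) $$ (e, c)) = 0"
      if ac: "a < p" "c < length ?J" for a c
    proof -
      have "0 = (\<Sum>j\<le>k. \<Sum>d<p. Q j $$ (a, d) * jet p x v (?J ! c) (\<lambda>b. cpoly_mat (Phat1 j * W) $$ (d, b)))"
        using jet0[OF Pc(3) _ ac(2)] by simp
      also have "\<dots> = jet p x v (?J ! c) (\<lambda>b. \<Sum>j\<le>k. \<Sum>d<p. 
          Polynomial.smult (Q j $$ (a, d)) (cpoly_mat (Phat1 j * W) $$ (d, b)))"
        by (simp add: jet_sum jet_smult)
      also have "\<dots> = jet p x v (?J ! c) (\<lambda>b. CD_kernel p P1 P2 H k z $$ (a, b)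
          + (\<Sum>l<N. \<Sum>e<p. Polynomial.smult (Z l a e) (cpoly_mat (P1 (Suc k + l)) $$ (e, b))))"
        by (rule jet_cong) (rule CD[OF ac(1)])
      also have "\<dots> = \<gamma> k z $$ (a, c) + (\<Sum>l<N. \<Sum>e<p. Z l a e * \<pi> (Suc k + l) $$ (e, c))"
        using ac by (simp add: jet_add jet_sum jet_smult \<pi>_idx \<gamma>_eq)
      finally show ?thesis by simp
    qed
    have "Q k = last_quasidet
            (\<Pi>\<^sub>N (Suc k)) (block_column p N (\<lambda>l. if l = N - 1 then 1\<^sub>m p else 0\<^sub>m p p))
            (\<gamma> k z)     (0\<^sub>m p p)"
      unfolding assms(20)
    proof (rule last_quasidet_block_column[where m="length ?J" and X=Z])
      fix a b assume ab: "a < p" "b < p"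
      let ?B = "\<lambda>l. if l = N - 1 then 1\<^sub>m p else 0\<^sub>m p p"
      have "(\<Sum>l<N. \<Sum>e<p. Z l a e * ?B l $$ (e, b)) = (\<Sum>l\<in>{N - 1}. \<Sum>e<p. Z l a e * ?B l $$ (e, b))"
        using N ab by (intro sum.mono_neutral_right) auto
      also have "\<dots> = Z (N - 1) a b"
        using ab by (simp add: if_distrib[where f="\<lambda>r. y * r" for y] cong: if_cong)
      \<comment> \<open>Since \<open>N \<ge> 1\<close>, the last block is column
        \<open>Suc k + (N - 1) = k + N\<close>. It lies beyond the band of every row
        \<open>j < k\<close>, and in row \<open>k\<close> it is the identity, which leaves
        \<open>Q k\<close>.\<close>
      also have "\<dots> = (\<Sum>j\<le>k. \<Sum>d<p. Q j $$ (a, d) * w j (k + N) d b)"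
        using ab N by (simp add: Z_def)
      also have "\<dots> = (\<Sum>j\<in>{k}. \<Sum>d<p. Q j $$ (a, d) * w j (k + N) d b)"
        using ab by (intro sum.mono_neutral_right) (auto simp: w0)
      also have "\<dots> = Q k $$ (a, b)"
        using ab by (simp add: w1 if_distrib[where f="\<lambda>r. y * r" for y] cong: if_cong)
      finally show "Q k $$ (a, b) = 0\<^sub>m p p $$ (a, b) + (\<Sum>l<N. \<Sum>e<p. Z l a e * ?B l $$ (e, b))"
        using ab by simp
    qed (use p N det X \<pi>c Qc in \<open>auto simp: assms(20) \<gamma>_eq\<close>)
    then show "transpose_mat (mat_at (cpoly_mat (Phat2 k)) z) * cmat (minv (Hhat k)) = last_quasidet
            (\<Pi>\<^sub>N (Suc k)) (block_column p N (\<lambda>l. if l = N - 1 then 1\<^sub>m p else 0\<^sub>m p p))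
            (\<gamma> k z)     (0\<^sub>m p p)" unfolding Q_def .
  }
qed

end
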